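(* Let $m\ge1$, $k\ge1$, let $\mu$ be any partition of $k$ with $\ell(\mu)$ parts, and let $\omega_\mu$ be a fixed element of $\mathfrak{S}_k$ of cycle type $\mu$. Then the sum of the terms of highest total degree (in $p_1,\ldots,p_m,q_1,\ldots,q_m$) in $(-1)^kF_\mu(\mathbf{p};-\mathbf{q})$ equals the sum of the terms of highest total degree in $$\sum_{(\alpha,\psi)\in\mathfrak{S}_k^{(m)}}\mathbf{p}^{\kappa^{(m)}(\alpha,\psi)}\,\mathbf{q}^{\kappa^{(m)}((\alpha,\psi)\circ\omega_\mu)},$$ that is, it equals $$\sum_{\substack{(\alpha,\psi)\in\mathfrak{S}_k^{(m)}\\ \kappa(\alpha)+\kappa(\alpha\omega_\mu)=k+\ell(\mu)}}\mathbf{p}^{\kappa^{(m)}(\alpha,\psi)}\,\mathbf{q}^{\kappa^{(m)}((\alpha,\psi)\circ\omega_\mu)}.$$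
   Context: Permutations are multiplied from right to left; $\kappa(\alpha)$ is the number of cycles of a permutation $\alpha$ (fixed points included); $[m]=\{1,\ldots,m\}$; $\mathbf{p}=(p_1,\ldots,p_m)$, $\mathbf{q}=(q_1,\ldots,q_m)$ are indeterminates and $-\mathbf{q}=(-q_1,\ldots,-q_m)$. Normalized characters. For partitions $\omega,\lambda$ of $n$, $\chi_\omega(\lambda)$ is the value of the irreducible character of the symmetric group $\mathfrak{S}_n$ indexed by $\omega$ on the conjugacy class of cycle type $\lambda$. For a partition $\mu$ of $k\le n$, $\widehat{\chi}_\omega(\mu\,1^{n-k})=n(n-1)\cdots(n-k+1)\,\dfrac{\chi_\omega(\mu\,1^{n-k})}{\chi_\omega(1^n)}$. Stanley's character polynomials. For positive integers $p_1,\ldots,p_m$ and $q_1\ge q_2\ge\cdots\ge q_m$, $\mathbf{p}\times\mathbf{q}$ denotes the partition of $n=\sum_i p_iq_i$ with $p_i$ parts of size $q_i$, $i=1,\ldots,m$. For a partition $\mu$ of $k$, $F_\mu(\mathbf{p};\mathbf{q})$ is the (known to exist) polynomial in the indeterminates $p_1,\ldots,p_m,q_1,\ldots,q_m$ whose value at every shape $\mathbf{p}\times\mathbf{q}$ that is a partition of some $n\ge k$ is $\widehat{\chi}_{\mathbf{p}\times\mathbf{q}}(\mu\,1^{n-k})$. Coloured permutations. $\mathfrak{S}_k^{(m)}$ is the set of pairs $(\alpha,\psi)$ where $\alpha\in\mathfrak{S}_k$ and $\psi$ is a function from the set of cycles of $\alpha$ to $[m]$. For $(\alpha,\psi)\in\mathfrak{S}_k^{(m)}$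 and $\beta\in\mathfrak{S}_k$, define $(\alpha,\psi)\circ\beta=(\gamma,\nu)\in\mathfrak{S}_k^{(m)}$ by $\gamma=\alpha\beta$ and, for each cycle $u$ of $\gamma$, $\nu(u)=\max\psi(w)$ over all cycles $w$ of $\alpha$ having an element in common with $u$. Let $\kappa_i^{(m)}(\alpha,\psi)$ be the number of cycles of $\alpha$ coloured $i$, and $\mathbf{p}^{\kappa^{(m)}(\alpha,\psi)}=\prod_{i=1}^m p_i^{\kappa_i^{(m)}(\alpha,\psi)}$, and similarly for $\mathbf{q}$. Recall that $\kappa(\alpha)+\kappa(\alpha\omega_\mu)\le k+\ell(\mu)$ for all $\alpha\in\mathfrak{S}_k$. *)

theory Defs
  imports
    Complex_Main
    "HOL-Library.Function_Algebras"
    "HOL-Library.FuncSet"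
    "HOL-Library.Multiset"
    "HOL-Library.Poly_Mapping"
    "HOL-Combinatorics.Permutations"
    "HOL-Combinatorics.Orbits"
begin

section \<open>Polynomials in several indeterminates\<close>

text \<open>A polynomial is a finitely supported map from monomials (finitely supported exponent
  functions) to coefficients; addition and multiplication are those of \<^theory>\<open>HOL-Library.Poly_Mapping\<close>.\<close>

type_synonym ('v, 'a) mpoly = "('v \<Rightarrow>\<^sub>0 nat) \<Rightarrow>\<^sub>0 'a"

definition mconst :: "'a \<Rightarrow> ('v, 'a::comm_ring_1) mpoly" where
  "mconst c = Poly_Mapping.single 0 c"

definition mvar :: "'v \<Rightarrow> ('v, 'a::comm_ring_1) mpoly" where
  "mvar v = Poly_Mapping.single (Poly_Mapping.single v 1) 1"

definition mvars :: "('v, 'a::comm_ring_1) mpoly \<Rightarrow> 'v set" where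
  "mvars F = (\<Union>t \<in> Poly_Mapping.keys F. Poly_Mapping.keys t)"

text \<open>Substitute \<open>x v\<close> for every indeterminate \<open>v\<close> and \<open>h c\<close> for every coefficient \<open>c\<close>.\<close>

definition msubst :: "('a \<Rightarrow> 'b) \<Rightarrow> ('v \<Rightarrow> 'b) \<Rightarrow> ('v, 'a::comm_ring_1) mpoly \<Rightarrow> 'b::comm_ring_1" where
  "msubst h x F =
     (\<Sum>t \<in> Poly_Mapping.keys F. h (Poly_Mapping.lookup F t) *
        (\<Prod>v \<in> Poly_Mapping.keys t. x v ^ Poly_Mapping.lookup t v))"

definition meval :: "('v \<Rightarrow> 'a) \<Rightarrow> ('v, 'a::comm_ring_1) mpoly \<Rightarrow> 'a" where
  "meval x F = msubst id x F"

definition monom_deg :: "('v \<Rightarrow>\<^sub>0 nat) \<Rightarrow> nat" where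
  "monom_deg t = (\<Sum>v \<in> Poly_Mapping.keys t. Poly_Mapping.lookup t v)"

definition total_deg :: "('v, 'a::comm_ring_1) mpoly \<Rightarrow> nat" where
  "total_deg F = Max (insert 0 (monom_deg ` Poly_Mapping.keys F))"

definition top_terms :: "('v, 'a::comm_ring_1) mpoly \<Rightarrow> ('v, 'a) mpoly" where
  "top_terms F =
     (\<Sum>t \<in> {t \<in> Poly_Mapping.keys F. monom_deg t = total_deg F}.
        Poly_Mapping.single t (Poly_Mapping.lookup F t))"


section \<open>Permutations, cycles and partitions\<close>

definition Sym :: "nat \<Rightarrow> (nat \<Rightarrow> nat) set" where
  "Sym n = {\<sigma>. \<sigma> permutes {1..n}}"

text \<open>For a fixed permutation, a cycle is determined by its underlying set.\<close>

definition cycles :: "nat \<Rightarrow> (nat \<Rightarrow> nat) \<Rightarrow> nat set set" where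
  "cycles n \<sigma> = orbit \<sigma> ` {1..n}"

definition num_cycles :: "nat \<Rightarrow> (nat \<Rightarrow> nat) \<Rightarrow> nat" where
  "num_cycles n \<sigma> = card (cycles n \<sigma>)"

definition cycle_type :: "nat \<Rightarrow> (nat \<Rightarrow> nat) \<Rightarrow> nat multiset" where
  "cycle_type n \<sigma> = image_mset card (mset_set (cycles n \<sigma>))"

definition is_partition :: "nat multiset \<Rightarrow> nat \<Rightarrow> bool" where
  "is_partition \<mu> n \<longleftrightarrow> 0 \<notin># \<mu> \<and> \<Sum>\<^sub># \<mu> = n"


section \<open>Irreducible characters of the symmetric group\<close>

global_interpretation fun_vec: vector_space "\<lambda>(c::complex) (f :: 'a \<Rightarrow> complex) x. c * f x"
  by unfold_locales (auto simp: fun_eq_iff algebra_simps)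

text \<open>Trace of an endomorphism \<open>T\<close> of a finite-dimensional subspace \<open>V\<close>,
  in an arbitrarily chosen basis of \<open>V\<close>.\<close>

definition trace_on ::
    "('a \<Rightarrow> complex) set \<Rightarrow> (('a \<Rightarrow> complex) \<Rightarrow> 'a \<Rightarrow> complex) \<Rightarrow> complex" where
  "trace_on V T =
     (let B = (SOME B. fun_vec.independent B \<and> fun_vec.span B = V)
      in \<Sum>b\<in>B. fun_vec.representation B (T b) b)"

definition group_algebra :: "nat \<Rightarrow> ((nat \<Rightarrow> nat) \<Rightarrow> complex) set" where
  "group_algebra n = {f. \<forall>\<sigma>. \<sigma> \<notin> Sym n \<longrightarrow> f \<sigma> = 0}"

definition ga_basis :: "(nat \<Rightarrow> nat) \<Rightarrow> (nat \<Rightarrow> nat) \<Rightarrow> complex" where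
  "ga_basis \<sigma> = (\<lambda>\<tau>. if \<tau> = \<sigma> then 1 else 0)"

definition ga_mult ::
    "nat \<Rightarrow> ((nat \<Rightarrow> nat) \<Rightarrow> complex) \<Rightarrow> ((nat \<Rightarrow> nat) \<Rightarrow> complex) \<Rightarrow> (nat \<Rightarrow> nat) \<Rightarrow> complex" where
  "ga_mult n f g = (\<lambda>\<sigma>. \<Sum>\<tau> \<in> Sym n. f \<tau> * g (inv \<tau> \<circ> \<sigma>))"

text \<open>The boxes (row, column) of the Young diagram of a partition, in reading order. Entry \<open>x\<close>
  of the canonical tableau (\<open>1 \<le> x \<le> n\<close>) occupies the \<open>x\<close>-th box; rows are numbered by weakly
  decreasing length.\<close>

definition boxes :: "nat multiset \<Rightarrow> (nat \<times> nat) list" where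
  "boxes \<omega> =
     (let r = rev (sorted_list_of_multiset \<omega>)
      in concat (map (\<lambda>i. map (\<lambda>j. (i, j)) [0..<r ! i]) [0..<length r]))"

definition box_of :: "nat multiset \<Rightarrow> nat \<Rightarrow> nat \<times> nat" where
  "box_of \<omega> x = boxes \<omega> ! (x - 1)"

definition row_group :: "nat multiset \<Rightarrow> (nat \<Rightarrow> nat) set" where
  "row_group \<omega> = {\<sigma> \<in> Sym (\<Sum>\<^sub># \<omega>).
     \<forall>x \<in> {1..\<Sum>\<^sub># \<omega>}. fst (box_of \<omega> (\<sigma> x)) = fst (box_of \<omega> x)}"

definition col_group :: "nat multiset \<Rightarrow> (nat \<Rightarrow> nat) set" where
  "col_group \<omega> = {\<sigma> \<in> Sym (\<Sum>\<^sub># \<omega>).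
     \<forall>x \<in> {1..\<Sum>\<^sub># \<omega>}. snd (box_of \<omega> (\<sigma> x)) = snd (box_of \<omega> x)}"

definition young_symmetrizer :: "nat multiset \<Rightarrow> (nat \<Rightarrow> nat) \<Rightarrow> complex" where
  "young_symmetrizer \<omega> =
     ga_mult (\<Sum>\<^sub># \<omega>)
       (\<lambda>\<sigma>. if \<sigma> \<in> row_group \<omega> then 1 else 0)
       (\<lambda>\<sigma>. if \<sigma> \<in> col_group \<omega> then of_int (sign \<sigma>) else 0)"

text \<open>The irreducible module indexed by \<open>\<omega>\<close>, realised as the left ideal of the group algebra
  generated by the Young symmetrizer. With this labelling the one-row partition gives the
  trivial character.\<close>

definition irr_module :: "nat multiset \<Rightarrow> ((nat \<Rightarrow> nat) \<Rightarrow> complex) set" where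
  "irr_module \<omega> =
     (\<lambda>f. ga_mult (\<Sum>\<^sub># \<omega>) f (young_symmetrizer \<omega>)) ` group_algebra (\<Sum>\<^sub># \<omega>)"

definition irr_char_perm :: "nat multiset \<Rightarrow> (nat \<Rightarrow> nat) \<Rightarrow> complex" where
  "irr_char_perm \<omega> \<sigma> = trace_on (irr_module \<omega>) (ga_mult (\<Sum>\<^sub># \<omega>) (ga_basis \<sigma>))"

definition irr_char :: "nat multiset \<Rightarrow> nat multiset \<Rightarrow> complex" where
  "irr_char \<omega> ty =
     irr_char_perm \<omega> (SOME \<sigma>. \<sigma> \<in> Sym (\<Sum>\<^sub># \<omega>) \<and> cycle_type (\<Sum>\<^sub># \<omega>) \<sigma> = ty)"

definition normalized_char :: "nat multiset \<Rightarrow> nat multiset \<Rightarrow> complex" where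
  "normalized_char \<omega> \<mu> =
     (let n = \<Sum>\<^sub># \<omega>; k = \<Sum>\<^sub># \<mu>
      in (\<Prod>i<k. of_nat n - of_nat i) *
         (irr_char \<omega> (\<mu> + replicate_mset (n - k) 1) / irr_char \<omega> (replicate_mset n 1)))"


section \<open>Stanley's character polynomials\<close>

datatype pq_var = Var_p nat | Var_q nat

definition shape :: "nat \<Rightarrow> (nat \<Rightarrow> nat) \<Rightarrow> (nat \<Rightarrow> nat) \<Rightarrow> nat multiset" where
  "shape m p q = (\<Sum>i\<in>{1..m}. replicate_mset (p i) (q i))"

definition is_stanley_char_poly :: "nat \<Rightarrow> nat multiset \<Rightarrow> (pq_var, complex) mpoly \<Rightarrow> bool" where
  "is_stanley_char_poly m \<mu> F \<longleftrightarrow>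
     mvars F \<subseteq> Var_p ` {1..m} \<union> Var_q ` {1..m} \<and>
     (\<forall>p q. (\<forall>i\<in>{1..m}. 0 < p i \<and> 0 < q i) \<and>
            (\<forall>i\<in>{1..m}. \<forall>j\<in>{1..m}. i \<le> j \<longrightarrow> q j \<le> q i) \<and>
            \<Sum>\<^sub># \<mu> \<le> (\<Sum>i\<in>{1..m}. p i * q i) \<longrightarrow>
        meval (\<lambda>v. case v of Var_p i \<Rightarrow> of_nat (p i) | Var_q i \<Rightarrow> of_nat (q i)) F
          = normalized_char (shape m p q) \<mu>)"

text \<open>For \<open>m \<ge> 1\<close> there is exactly one such polynomial.\<close>

definition stanley_char_poly :: "nat \<Rightarrow> nat multiset \<Rightarrow> (pq_var, complex) mpoly" where
  "stanley_char_poly m \<mu> = (THE F. is_stanley_char_poly m \<mu> F)"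

definition negate_q :: "(pq_var, complex) mpoly \<Rightarrow> (pq_var, complex) mpoly" where
  "negate_q F = msubst mconst (\<lambda>v. case v of Var_p i \<Rightarrow> mvar (Var_p i) | Var_q i \<Rightarrow> - mvar (Var_q i)) F"


section \<open>Coloured permutations\<close>

definition coloured_perms :: "nat \<Rightarrow> nat \<Rightarrow> ((nat \<Rightarrow> nat) \<times> (nat set \<Rightarrow> nat)) set" where
  "coloured_perms k m = (SIGMA \<alpha> : Sym k. cycles k \<alpha> \<rightarrow>\<^sub>E {1..m})"

fun coloured_mult :: "nat \<Rightarrow> (nat \<Rightarrow> nat) \<times> (nat set \<Rightarrow> nat) \<Rightarrow> (nat \<Rightarrow> nat)
    \<Rightarrow> (nat \<Rightarrow> nat) \<times> (nat set \<Rightarrow> nat)" where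
  "coloured_mult k (\<alpha>, \<psi>) \<beta> =
     (\<alpha> \<circ> \<beta>,
      \<lambda>u \<in> cycles k (\<alpha> \<circ> \<beta>). Max (\<psi> ` {w \<in> cycles k \<alpha>. w \<inter> u \<noteq> {}}))"

fun colour_count :: "nat \<Rightarrow> nat \<Rightarrow> (nat \<Rightarrow> nat) \<times> (nat set \<Rightarrow> nat) \<Rightarrow> nat" where
  "colour_count k i (\<alpha>, \<psi>) = card {u \<in> cycles k \<alpha>. \<psi> u = i}"

definition colour_monom :: "nat \<Rightarrow> nat \<Rightarrow> (nat \<Rightarrow> pq_var) \<Rightarrow>
    (nat \<Rightarrow> nat) \<times> (nat set \<Rightarrow> nat) \<Rightarrow> (pq_var, complex) mpoly" where
  "colour_monom k m X a = (\<Prod>i\<in>{1..m}. mvar (X i) ^ colour_count k i a)"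

end

theory Submission
  imports Defs "HOL-Computational_Algebra.Polynomial"
begin

text \<open>The identity holds before passing to top terms: by the formula of Feray and Sniady,
  \<open>(-1)\<^sup>k F\<^sub>\<mu>(p; -q)\<close> is the whole sum over coloured permutations.

  Let \<open>e\<close> be the Young symmetrizer. Since \<open>e\<^sup>2 = c e\<close> with \<open>c \<noteq> 0\<close>, right multiplication by \<open>e / c\<close>
  projects the group algebra onto the irreducible module, so the character at \<open>\<pi>\<close> is
  \<open>(\<Sum>g. e (g\<^sup>-\<^sup>1 \<pi>\<^sup>-\<^sup>1 g)) / c\<close>. Writing \<open>e\<close> as a signed sum over row and column permutations turns the
  normalized character into a signed count of pairs of an injection \<open>f\<close> of \<open>[k]\<close> into the boxes and
  an \<open>\<alpha> \<in> Sym k\<close> such that \<open>\<alpha>\<close> preserves the rows and \<open>\<alpha>\<omega>\<close> the columns of \<open>f\<close>. For non-injective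
  \<open>f\<close> the signs cancel, so all maps \<open>f\<close> may be admitted, and then the rows and columns can be chosen
  cycle by cycle. In a shape made of rectangular blocks this count is the coloured sum. Its terms
  have degree \<open>\<kappa>(\<alpha>) + \<kappa>(\<alpha>\<omega>)\<close>, and no cancellation can occur in top degree because the
  coefficients are positive.\<close>

subsection \<open>Traces\<close>

text \<open>The maximum in the colour rule comes from the shape: a column index is admissible for a
  cycle of \<open>\<alpha> \<circ> \<beta>\<close> iff it is smaller than the length of every row
  that this cycle meets, and as \<open>q\<close> is weakly decreasing, a shortest such row belongs
  to the largest colour met.

  The signs disappear because a permutation of [k] with c cycles has sign (-1)^(k - c), while
  replacing q by -q contributes (-1)^c; together with the factor (-1)^k every term gets the
  coefficient 1.

  That the scalar c is nonzero follows from positivity of the form that sends f to the coefficient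
  of the identity in \<open>f\<close> times \<open>ga_star f\<close>, so no dimension has to be
  computed.

  The polynomial is given by a definite description, and its values are prescribed only at positive
  integers with weakly decreasing \<open>q\<close> and large enough size. Uniqueness therefore needs
  evaluation points that lie in this region and still separate all monomials.\<close>

abbreviation (input) fun_linear :: "(('a \<Rightarrow> complex) \<Rightarrow> 'b \<Rightarrow> complex) \<Rightarrow> bool" where
  "fun_linear \<equiv> Vector_Spaces.linear (\<lambda>c f x. c * f x) (\<lambda>c f x. c * f x)"

lemma fun_linearI:
  assumes "\<And>f g. T (f + g) = T f + T g" "\<And>c f. T (\<lambda>x. c * f x) = (\<lambda>x. c * T f x)"
  shows "fun_linear T"
  using assms
  by (auto simp: Vector_Spaces.linear_iff fun_vec.vector_space_axioms)

lemma sum_fun_apply: "(\<Sum>i\<in>A. F i) x = (\<Sum>i\<in>A. F i x)"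
  by (induction A rule: infinite_finite_induct) auto

text \<open>\<open>R\<close> is a projection onto \<open>V\<close> and \<open>T\<close> preserves
  \<open>V\<close>, so the trace of \<open>T\<close> on \<open>V\<close> is the trace of
  \<open>T \<circ> R\<close> on all functions supported on \<open>G\<close>. The latter is read off
  in the basis of point masses, whatever basis \<open>trace_on\<close> has picked.\<close>

lemma trace_on_projection:
  fixes R T :: "('a \<Rightarrow> complex) \<Rightarrow> 'a \<Rightarrow> complex"
  assumes fin: "finite G" and linR: "fun_linear R" and linT: "fun_linear T"
    and supp: "\<And>v x. v \<in> V \<Longrightarrow> x \<notin> G \<Longrightarrow> v x = 0"
    and V: "V = R ` {f. \<forall>x. x \<notin> G \<longrightarrow> f x = 0}"
    and RV: "\<And>v. v \<in> V \<Longrightarrow> R v = v" and TV: "\<And>v. v \<in> V \<Longrightarrow> T v \<in> V"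
  shows "trace_on V T = (\<Sum>g\<in>G. T (R (\<lambda>x. if x = g then 1 else 0)) g)"
proof -
  interpret R: Vector_Spaces.linear "\<lambda>c f x. c * f x" "\<lambda>c f x. c * f x" R by (rule linR)
  interpret T: Vector_Spaces.linear "\<lambda>c f x. c * f x" "\<lambda>c f x. c * f x" T by (rule linT)
  define W where "W = {f :: 'a \<Rightarrow> complex. \<forall>x. x \<notin> G \<longrightarrow> f x = 0}"
  define \<delta> :: "'a \<Rightarrow> 'a \<Rightarrow> complex" where "\<delta> = (\<lambda>g x. if x = g then 1 else 0)"
  have "fun_vec.subspace W"
    by (auto simp: fun_vec.subspace_def W_def)
  then have subV: "fun_vec.subspace V"
    unfolding V W_def by (rule R.subspace_image)
  define B where "B = (SOME B. fun_vec.independent B \<and> fun_vec.span B = V)"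
  have "\<exists>B. fun_vec.independent B \<and> fun_vec.span B = V"
    by (metis fun_vec.maximal_independent_subset fun_vec.span_mono fun_vec.span_eq_iff subV subset_antisym)
  then have B: "fun_vec.independent B" "fun_vec.span B = V"
    unfolding B_def by (metis (mono_tags, lifting) someI_ex)+
  have expand: "v = (\<Sum>g\<in>G. (\<lambda>x. v g * \<delta> g x))" if "v \<in> W" for v
    using that fin by (auto simp: W_def \<delta>_def fun_eq_iff sum_fun_apply if_distrib cong: if_cong)
  have \<delta>W: "\<delta> g \<in> W" if "g \<in> G" for g
    using that by (auto simp: W_def \<delta>_def)
  have VW: "V \<subseteq> W" using supp by (auto simp: W_def)
  have Rexp: "R v = (\<Sum>g\<in>G. (\<lambda>x. v g * R (\<delta> g) x))" if "v \<in> W" for v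
  proof -
    have "R v = R (\<Sum>g\<in>G. (\<lambda>x. v g * \<delta> g x))" using expand[OF that] by simp
    also have "\<dots> = (\<Sum>g\<in>G. (\<lambda>x. v g * R (\<delta> g) x))" by (simp add: R.sum R.scale)
    finally show ?thesis .
  qed
  \<comment> \<open>The images of the finitely many point masses span \<open>V\<close>, which forces
    the independent set \<open>B\<close> to be finite.\<close>
  have "V \<subseteq> fun_vec.span (R ` \<delta> ` G)"
  proof
    fix v assume v: "v \<in> V"
    then have "v = (\<Sum>g\<in>G. (\<lambda>x. v g * R (\<delta> g) x))" using Rexp RV VW by (metis subsetD)
    also have "\<dots> \<in> fun_vec.span (R ` \<delta> ` G)"
      by (intro fun_vec.span_sum fun_vec.span_scale fun_vec.span_base) auto
    finally show "v \<in> fun_vec.span (R ` \<delta> ` G)" .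
  qed
  moreover have "B \<subseteq> V" using B fun_vec.span_superset by blast
  ultimately have finB: "finite B"
    using fun_vec.independent_span_bound[of "R ` \<delta> ` G" B] fin B by auto
  let ?r = "fun_vec.representation B"
  have in_V: "T (R (\<delta> g)) \<in> V" if "g \<in> G" for g
    using TV \<delta>W[OF that] by (auto simp: V W_def)
  \<comment> \<open>Expand each vector in \<open>B\<close> and evaluate at \<open>g\<close>; after
    the sums are swapped, the values \<open>b g\<close> are the coefficients that reassemble
    \<open>b\<close> from the vectors \<open>R (\<delta> g)\<close>.\<close>
  have "(\<Sum>g\<in>G. T (R (\<delta> g)) g) = (\<Sum>g\<in>G. \<Sum>b\<in>B. ?r (T (R (\<delta> g))) b * b g)"
  proof (intro sum.cong refl)
    fix g assume "g \<in> G"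
    then have "T (R (\<delta> g)) = (\<Sum>b\<in>B. (\<lambda>x. ?r (T (R (\<delta> g))) b * b x))"
      using fun_vec.sum_representation_eq[of B "T (R (\<delta> g))" B] B finB in_V by simp
    then have "T (R (\<delta> g)) g = (\<Sum>b\<in>B. (\<lambda>x. ?r (T (R (\<delta> g))) b * b x)) g" by metis
    then show "T (R (\<delta> g)) g = (\<Sum>b\<in>B. ?r (T (R (\<delta> g))) b * b g)"
      by (simp add: sum_fun_apply)
  qed
  also have "\<dots> = (\<Sum>b\<in>B. \<Sum>g\<in>G. b g * ?r (T (R (\<delta> g))) b)"
    by (subst sum.swap) (simp add: mult.commute)
  also have "\<dots> = (\<Sum>b\<in>B. ?r (T b) b)"
  proof (intro sum.cong refl)
    fix b assume b: "b \<in> B"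
    then have "b \<in> V" using \<open>B \<subseteq> V\<close> by auto
    then have "b = (\<Sum>g\<in>G. (\<lambda>x. b g * R (\<delta> g) x))" using Rexp RV VW by (metis subsetD)
    then have "T b = T (\<Sum>g\<in>G. (\<lambda>x. b g * R (\<delta> g) x))" by metis
    also have "\<dots> = (\<Sum>g\<in>G. (\<lambda>x. b g * T (R (\<delta> g)) x))" by (simp add: T.sum T.scale)
    finally have "?r (T b) = ?r (\<Sum>g\<in>G. (\<lambda>x. b g * T (R (\<delta> g)) x))" by simp
    also have "\<dots> = (\<lambda>c. \<Sum>g\<in>G. ?r (\<lambda>x. b g * T (R (\<delta> g)) x) c)"
      using B in_V by (intro fun_vec.representation_sum fun_vec.span_scale) auto
    also have "\<dots> = (\<lambda>c. \<Sum>g\<in>G. b g * ?r (T (R (\<delta> g))) c)"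
      using B in_V by (intro ext sum.cong refl) (subst fun_vec.representation_scale; auto)
    finally show "(\<Sum>g\<in>G. b g * ?r (T (R (\<delta> g))) b) = ?r (T b) b" by simp
  qed
  finally show ?thesis unfolding trace_on_def Let_def B_def[symmetric] \<delta>_def by (rule sym)
qed

subsection \<open>The group algebra\<close>

lemma finite_Sym [simp]: "finite (Sym n)"
  by (simp add: Sym_def finite_permutations)

lemma Sym_id [simp]: "id \<in> Sym n" by (simp add: Sym_def permutes_id)

lemma Sym_comp: "\<sigma> \<in> Sym n \<Longrightarrow> \<tau> \<in> Sym n \<Longrightarrow> \<sigma> \<circ> \<tau> \<in> Sym n"
  by (simp add: Sym_def permutes_compose)

lemma Sym_inv: "\<sigma> \<in> Sym n \<Longrightarrow> inv \<sigma> \<in> Sym n"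
  by (simp add: Sym_def permutes_inv)

lemma Sym_inv_o [simp]:
  assumes "\<sigma> \<in> Sym n"
  shows "inv \<sigma> \<circ> \<sigma> = id" "\<sigma> \<circ> inv \<sigma> = id" "inv (inv \<sigma>) = \<sigma>"
    "inv \<sigma> \<circ> (\<sigma> \<circ> f) = f" "\<sigma> \<circ> (inv \<sigma> \<circ> f) = f" "h \<circ> inv \<sigma> \<circ> \<sigma> = h" "h \<circ> \<sigma> \<circ> inv \<sigma> = h"
    "inv \<sigma> (\<sigma> x) = x" "\<sigma> (inv \<sigma> x) = x"
  using assms unfolding Sym_def
  by (simp_all add: permutes_inv_o permutes_inv_inv permutes_inverses fun_eq_iff)

lemma Sym_inv_comp:
  "\<sigma> \<in> Sym n \<Longrightarrow> \<tau> \<in> Sym n \<Longrightarrow> inv (\<sigma> \<circ> \<tau>) = inv \<tau> \<circ> inv \<sigma>"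
  by (simp add: Sym_def o_inv_distrib permutes_bij)

lemma Sym_comp_left_cancel: "\<sigma> \<in> Sym n \<Longrightarrow> \<sigma> \<circ> \<tau> \<in> Sym n \<longleftrightarrow> \<tau> \<in> Sym n"
  by (metis Sym_comp Sym_inv Sym_inv_o(4))

lemma Sym_in_range: "\<sigma> \<in> Sym n \<Longrightarrow> \<sigma> x \<in> {1..n} \<longleftrightarrow> x \<in> {1..n}"
  using permutes_in_image[of \<sigma> "{1..n}" x] by (simp add: Sym_def)

lemma Sym_permutation: "\<sigma> \<in> Sym n \<Longrightarrow> permutation \<sigma>"
  by (metis Sym_def finite_atLeastAtMost mem_Collect_eq permutes_imp_permutation)

lemma Sym_sum_inv: "(\<Sum>\<sigma>\<in>Sym n. f (inv \<sigma>)) = (\<Sum>\<sigma>\<in>Sym n. f \<sigma>)"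
  by (rule sum.reindex_bij_witness[where i = inv and j = inv]) (auto simp: Sym_inv)

lemma Sym_sum_comp_left:
  assumes "\<tau> \<in> Sym n" shows "(\<Sum>\<sigma>\<in>Sym n. f (\<tau> \<circ> \<sigma>)) = (\<Sum>\<sigma>\<in>Sym n. f \<sigma>)"
  by (rule sum.reindex_bij_witness[where i = "\<lambda>\<sigma>. inv \<tau> \<circ> \<sigma>" and j = "\<lambda>\<sigma>. \<tau> \<circ> \<sigma>"])
     (use assms in \<open>auto simp: Sym_inv Sym_comp\<close>)

lemma ga_mult_assoc: "ga_mult n (ga_mult n f g) h = ga_mult n f (ga_mult n g h)"
proof
  fix \<sigma>
  have "ga_mult n (ga_mult n f g) h \<sigma>
     = (\<Sum>\<tau>\<in>Sym n. \<Sum>\<rho>\<in>Sym n. f \<rho> * g (inv \<rho> \<circ> \<tau>) * h (inv \<tau> \<circ> \<sigma>))"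
    by (simp add: ga_mult_def sum_distrib_right)
  also have "\<dots> = (\<Sum>\<rho>\<in>Sym n. \<Sum>\<tau>\<in>Sym n. f \<rho> * g (inv \<rho> \<circ> \<tau>) * h (inv \<tau> \<circ> \<sigma>))"
    by (rule sum.swap)
  also have "\<dots> = (\<Sum>\<rho>\<in>Sym n. \<Sum>\<tau>\<in>Sym n. f \<rho> * g \<tau> * h (inv \<tau> \<circ> (inv \<rho> \<circ> \<sigma>)))"
  proof (rule sum.cong[OF refl])
    fix \<rho> assume \<rho>: "\<rho> \<in> Sym n"
    have "(\<Sum>\<tau>\<in>Sym n. f \<rho> * g (inv \<rho> \<circ> \<tau>) * h (inv \<tau> \<circ> \<sigma>))
        = (\<Sum>\<tau>\<in>Sym n. f \<rho> * g (inv \<rho> \<circ> (\<rho> \<circ> \<tau>)) * h (inv (\<rho> \<circ> \<tau>) \<circ> \<sigma>))"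
      by (rule Sym_sum_comp_left[OF \<rho>, symmetric])
    then show "(\<Sum>\<tau>\<in>Sym n. f \<rho> * g (inv \<rho> \<circ> \<tau>) * h (inv \<tau> \<circ> \<sigma>))
        = (\<Sum>\<tau>\<in>Sym n. f \<rho> * g \<tau> * h (inv \<tau> \<circ> (inv \<rho> \<circ> \<sigma>)))"
      using \<rho> by (simp add: Sym_inv_comp o_assoc)
  qed
  also have "\<dots> = ga_mult n f (ga_mult n g h) \<sigma>"
    by (simp add: ga_mult_def sum_distrib_left mult.assoc)
  finally show "ga_mult n (ga_mult n f g) h \<sigma> = ga_mult n f (ga_mult n g h) \<sigma>" .
qed

lemma fun_linear_ga_mult_left: "fun_linear (ga_mult n f)"
  by (rule fun_linearI)
     (auto simp: ga_mult_def fun_eq_iff algebra_simps sum.distrib sum_distrib_left)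

lemma fun_linear_ga_mult_right: "fun_linear (\<lambda>f. ga_mult n f g)"
  by (rule fun_linearI)
     (auto simp: ga_mult_def fun_eq_iff algebra_simps sum.distrib sum_distrib_left)

lemma ga_mult_scale_left: "ga_mult n (\<lambda>x. c * f x) g = (\<lambda>x. c * ga_mult n f g x)"
  by (auto simp: ga_mult_def fun_eq_iff sum_distrib_left mult.assoc)

lemma ga_mult_scale_right: "ga_mult n f (\<lambda>x. c * g x) = (\<lambda>x. c * ga_mult n f g x)"
  by (auto simp: ga_mult_def fun_eq_iff sum_distrib_left algebra_simps)

lemma ga_mult_basis_left:
  "\<pi> \<in> Sym n \<Longrightarrow> ga_mult n (ga_basis \<pi>) f \<sigma> = f (inv \<pi> \<circ> \<sigma>)"
  by (simp add: ga_mult_def ga_basis_def if_distrib[of "\<lambda>x. x * _"] sum.delta cong: if_cong)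

lemma ga_mult_in_group_algebra: "g \<in> group_algebra n \<Longrightarrow> ga_mult n f g \<in> group_algebra n"
  by (auto simp: group_algebra_def ga_mult_def Sym_comp_left_cancel Sym_inv intro!: sum.neutral)

text \<open>The summand is the coefficient of \<open>g\<close> in the product of
  \<open>\<pi>\<close>, \<open>g\<close> and \<open>e / c\<close>, a diagonal entry in the basis of
  group elements.\<close>

lemma trace_left_ideal:
  assumes e: "e \<in> group_algebra n" and ee: "ga_mult n e e = (\<lambda>\<sigma>. c * e \<sigma>)" and c: "c \<noteq> 0"
    and \<pi>: "\<pi> \<in> Sym n"
  shows "trace_on ((\<lambda>f. ga_mult n f e) ` group_algebra n) (ga_mult n (ga_basis \<pi>))
       = (\<Sum>g\<in>Sym n. e (inv g \<circ> inv \<pi> \<circ> g)) / c"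
proof -
  define R where "R = (\<lambda>f. ga_mult n f (\<lambda>\<sigma>. inverse c * e \<sigma>))"
  define V where "V = (\<lambda>f. ga_mult n f e) ` group_algebra n"
  have R: "R f = (\<lambda>\<sigma>. inverse c * ga_mult n f e \<sigma>)" for f
    by (simp add: R_def ga_mult_scale_right)
  have sc: "(\<lambda>\<sigma>. a * f \<sigma>) \<in> group_algebra n" if "f \<in> group_algebra n" for a f
    using that by (auto simp: group_algebra_def)
  have "V = R ` group_algebra n"
  proof safe
    fix v assume "v \<in> V"
    then obtain f where f: "f \<in> group_algebra n" "v = ga_mult n f e" by (auto simp: V_def)
    then have "v = R (\<lambda>\<sigma>. c * f \<sigma>)" using c by (simp add: R ga_mult_scale_left)
    then show "v \<in> R ` group_algebra n" using sc f by blast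
  next
    fix f assume "f \<in> group_algebra n"
    then show "R f \<in> V"
      by (auto simp: V_def R ga_mult_scale_left[symmetric] intro!: imageI sc)
  qed
  moreover have "R v = v" if "v \<in> V" for v
    using that c by (auto simp: V_def R ga_mult_assoc ee ga_mult_scale_right)
  moreover have "ga_mult n (ga_basis \<pi>) v \<in> V" if "v \<in> V" for v
    using that by (auto simp: V_def ga_mult_assoc[symmetric] image_iff
        intro!: bexI[OF _ ga_mult_in_group_algebra])
  moreover have "v x = 0" if "v \<in> V" "x \<notin> Sym n" for v x
    using that ga_mult_in_group_algebra[OF e] by (auto simp: V_def group_algebra_def)
  ultimately have "trace_on V (ga_mult n (ga_basis \<pi>))
     = (\<Sum>g\<in>Sym n. ga_mult n (ga_basis \<pi>) (R (\<lambda>x. if x = g then 1 else 0)) g)"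
    unfolding group_algebra_def R_def
    by (intro trace_on_projection[OF finite_Sym fun_linear_ga_mult_right fun_linear_ga_mult_left])
  also have "\<dots> = (\<Sum>g\<in>Sym n. inverse c * e (inv g \<circ> inv \<pi> \<circ> g))"
    using \<pi> unfolding ga_basis_def[symmetric]
    by (intro sum.cong refl) (simp add: ga_mult_basis_left R o_assoc Sym_inv)
  finally show ?thesis by (simp add: V_def sum_distrib_left[symmetric] divide_inverse mult.commute)
qed

subsection \<open>Quasi-idempotency of the Young symmetrizer\<close>

text \<open>The adjoint for the standard Hermitian form on the group algebra; it reverses
  products.\<close>

definition ga_star :: "((nat \<Rightarrow> nat) \<Rightarrow> complex) \<Rightarrow> (nat \<Rightarrow> nat) \<Rightarrow> complex" where
  "ga_star f = (\<lambda>\<sigma>. cnj (f (inv \<sigma>)))"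

lemma ga_star_mult:
  assumes "\<sigma> \<in> Sym n"
  shows "ga_star (ga_mult n f g) \<sigma> = ga_mult n (ga_star g) (ga_star f) \<sigma>"
proof -
  have "ga_star (ga_mult n f g) \<sigma> = (\<Sum>\<tau>\<in>Sym n. cnj (f \<tau>) * cnj (g (inv \<tau> \<circ> inv \<sigma>)))"
    by (simp add: ga_star_def ga_mult_def)
  also have "\<dots> = (\<Sum>\<tau>\<in>Sym n. cnj (f (inv \<sigma> \<circ> \<tau>)) * cnj (g (inv (inv \<sigma> \<circ> \<tau>) \<circ> inv \<sigma>)))"
    using Sym_sum_comp_left[OF Sym_inv[OF assms]] by (rule sym)
  also have "\<dots> = ga_mult n (ga_star g) (ga_star f) \<sigma>"
    using assms unfolding ga_mult_def ga_star_def
    by (intro sum.cong refl)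
       (simp add: Sym_inv_comp[where n = n] Sym_inv_o[where n = n] Sym_inv mult.commute)
  finally show ?thesis .
qed

text \<open>The coefficient of the identity in this product is the sum of the squared absolute
  values of the coefficients of \<open>f\<close>.\<close>

lemma ga_star_pos:
  assumes "f \<in> group_algebra n" "ga_mult n f (ga_star f) id = 0"
  shows "f = 0"
proof -
  have "0 = (\<Sum>\<tau>\<in>Sym n. f \<tau> * cnj (f \<tau>))"
    using assms(2) by (simp add: ga_mult_def ga_star_def cong: sum.cong)
  also have "\<dots> = of_real (\<Sum>\<tau>\<in>Sym n. (cmod (f \<tau>))\<^sup>2)"
    by (simp flip: complex_norm_square)
  finally have "(\<Sum>\<tau>\<in>Sym n. (cmod (f \<tau>))\<^sup>2) = 0" by (metis of_real_eq_0_iff)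
  then have "\<forall>\<tau>\<in>Sym n. f \<tau> = 0" by (subst (asm) sum_nonneg_eq_0_iff) auto
  then show ?thesis using assms(1) by (auto simp: group_algebra_def fun_eq_iff)
qed

text \<open>Identities for \<open>ga_star\<close> are available only at permutations in
  \<open>Sym n\<close>; this lets them be used inside products.\<close>

lemma ga_mult_cong:
  assumes "\<And>\<sigma>. \<sigma> \<in> Sym n \<Longrightarrow> f \<sigma> = f' \<sigma>" "\<And>\<sigma>. \<sigma> \<in> Sym n \<Longrightarrow> g \<sigma> = g' \<sigma>" "\<sigma> \<in> Sym n"
  shows "ga_mult n f g \<sigma> = ga_mult n f' g' \<sigma>"
  unfolding ga_mult_def using assms by (intro sum.cong) (auto simp: Sym_comp Sym_inv)

text \<open>One notion for two uses: with the coordinates of the boxes as \<open>f\<close> it gives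
  the row and column groups, and with coordinates composed with a filling it says that a permutation
  of positions preserves the rows or columns of that filling.\<close>

definition stab :: "nat \<Rightarrow> (nat \<Rightarrow> 'a) \<Rightarrow> (nat \<Rightarrow> nat) set" where
  "stab n f = {\<sigma> \<in> Sym n. \<forall>x\<in>{1..n}. f (\<sigma> x) = f x}"

lemma stab_Sym: "\<sigma> \<in> stab n f \<Longrightarrow> \<sigma> \<in> Sym n"
  by (simp add: stab_def)

lemma stab_apply: "\<sigma> \<in> stab n f \<Longrightarrow> x \<in> {1..n} \<Longrightarrow> f (\<sigma> x) = f x"
  by (simp add: stab_def)

lemma id_stab: "id \<in> stab n f" by (simp add: stab_def)

lemma stab_comp:
  assumes "\<sigma> \<in> stab n f" "\<tau> \<in> stab n f" shows "\<sigma> \<circ> \<tau> \<in> stab n f"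
  unfolding stab_def
proof (intro CollectI conjI ballI)
  show "\<sigma> \<circ> \<tau> \<in> Sym n" using assms by (intro Sym_comp stab_Sym)
  fix x assume x: "x \<in> {1..n}"
  then have "\<tau> x \<in> {1..n}" using Sym_in_range[OF stab_Sym] assms by blast
  then show "f ((\<sigma> \<circ> \<tau>) x) = f x" using x assms by (simp only: stab_apply o_apply)
qed

lemma stab_inv:
  assumes "\<sigma> \<in> stab n f" shows "inv \<sigma> \<in> stab n f"
  unfolding stab_def
proof (intro CollectI conjI ballI)
  show "inv \<sigma> \<in> Sym n" using assms by (intro Sym_inv stab_Sym)
  fix x assume "x \<in> {1..n}"
  then have "inv \<sigma> x \<in> {1..n}" using Sym_in_range[OF Sym_inv[OF stab_Sym]] assms by blast
  from stab_apply[OF assms this] show "f (inv \<sigma> x) = f x"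
    using Sym_inv_o(9)[OF stab_Sym[OF assms]] by simp
qed

lemma stab_left_iff: "\<sigma> \<in> stab n f \<Longrightarrow> \<sigma> \<circ> \<tau> \<in> stab n f \<longleftrightarrow> \<tau> \<in> stab n f"
  by (metis stab_comp stab_inv stab_Sym Sym_inv_o(4))

lemma stab_right_iff: "\<sigma> \<in> stab n f \<Longrightarrow> \<tau> \<circ> \<sigma> \<in> stab n f \<longleftrightarrow> \<tau> \<in> stab n f"
  by (metis stab_comp stab_inv stab_Sym Sym_inv_o(7))

lemma transpose_stab:
  "x \<in> {1..n} \<Longrightarrow> y \<in> {1..n} \<Longrightarrow> f x = f y \<Longrightarrow> transpose x y \<in> stab n f"
  by (auto simp: stab_def Sym_def transpose_def intro!: permutes_swap_id)

lemma inj_on_pair_fibre: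
  assumes "inj_on (\<lambda>w. (f w, h w)) A" shows "inj_on h {w \<in> A. f w = i \<and> R w}"
  by (rule inj_onI, rule inj_onD[OF assms]) auto

text \<open>The arguments only need the coordinates of the entries, so the list encoding of
  \<open>boxes\<close> is replaced by a bijection onto left-justified rows of lengths
  \<open>len\<close>.\<close>

locale diagram =
  fixes n L :: nat and len row col :: "nat \<Rightarrow> nat"
  assumes bij: "bij_betw (\<lambda>x. (row x, col x)) {1..n} {(i, j). i < L \<and> j < len i}"
begin

abbreviation P where "P \<equiv> stab n row"
abbreviation Q where "Q \<equiv> stab n col"

abbreviation a :: "(nat \<Rightarrow> nat) \<Rightarrow> complex" where "a \<equiv> \<lambda>\<sigma>. if \<sigma> \<in> P then 1 else 0"
abbreviation b :: "(nat \<Rightarrow> nat) \<Rightarrow> complex" where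
  "b \<equiv> \<lambda>\<sigma>. if \<sigma> \<in> Q then of_int (sign \<sigma>) else 0"
definition e where "e = ga_mult n a b"

lemma box_eq: "x \<in> {1..n} \<Longrightarrow> y \<in> {1..n} \<Longrightarrow> row x = row y \<Longrightarrow> col x = col y \<Longrightarrow> x = y"
  using inj_onD[OF bij_betw_imp_inj_on[OF bij], of x y] by simp

lemma row_col_less: "x \<in> {1..n} \<Longrightarrow> row x < L \<and> col x < len (row x)"
  using bij_betwE[OF bij] by fast

lemma ex_box:
  assumes "i < L" "j < len i" shows "\<exists>x\<in>{1..n}. row x = i \<and> col x = j"
proof -
  have "(i, j) \<in> (\<lambda>x. (row x, col x)) ` {1..n}"
    using assms bij_betw_imp_surj_on[OF bij] by simp
  then show ?thesis by force
qed

lemma P_Int_Q: "\<sigma> \<in> P \<Longrightarrow> \<sigma> \<in> Q \<Longrightarrow> \<sigma> = id"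
proof
  fix x assume \<sigma>: "\<sigma> \<in> P" "\<sigma> \<in> Q"
  show "\<sigma> x = id x"
  proof (cases "x \<in> {1..n}")
    case True
    then show ?thesis
      using box_eq[of "\<sigma> x" x] \<sigma> Sym_in_range[OF stab_Sym[OF \<sigma>(1)], of x] stab_apply
      by (metis id_apply)
  next
    case False
    then show ?thesis using stab_Sym[OF \<sigma>(1)] by (auto simp: Sym_def permutes_def)
  qed
qed

lemma e_expand:
  "e \<sigma> = (\<Sum>s\<in>Sym n. if s \<in> P \<and> inv s \<circ> \<sigma> \<in> Q then of_int (sign (inv s \<circ> \<sigma>)) else 0)"
  unfolding e_def ga_mult_def by (intro sum.cong) auto

lemma a_left: "p \<in> P \<Longrightarrow> a (p \<circ> \<sigma>) = a \<sigma>"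
  by (simp add: stab_left_iff)

lemma sign_comp: "\<sigma> \<in> Sym n \<Longrightarrow> \<tau> \<in> Sym n \<Longrightarrow> sign (\<sigma> \<circ> \<tau>) = sign \<sigma> * sign \<tau>"
  by (simp add: sign_compose Sym_permutation)

lemma b_right: "q \<in> Q \<Longrightarrow> b (\<sigma> \<circ> q) = of_int (sign q) * b \<sigma>"
  by (auto simp: stab_right_iff sign_comp stab_Sym)

lemma mult_left_invariant:
  assumes "\<And>\<sigma>. \<sigma> \<in> Sym n \<Longrightarrow> f (p \<circ> \<sigma>) = f \<sigma>" "p \<in> Sym n"
  shows "ga_mult n f g (p \<circ> \<sigma>) = ga_mult n f g \<sigma>"
proof -
  have "ga_mult n f g (p \<circ> \<sigma>) = (\<Sum>\<tau>\<in>Sym n. f (p \<circ> \<tau>) * g (inv (p \<circ> \<tau>) \<circ> (p \<circ> \<sigma>)))"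
    unfolding ga_mult_def by (rule Sym_sum_comp_left[OF assms(2), symmetric])
  also have "\<dots> = ga_mult n f g \<sigma>"
    unfolding ga_mult_def using assms
    by (intro sum.cong refl) (simp add: Sym_inv_comp comp_assoc)
  finally show ?thesis .
qed

lemma mult_right_invariant:
  assumes "\<And>\<sigma>. g (\<sigma> \<circ> q) = c * g \<sigma>"
  shows "ga_mult n f g (\<sigma> \<circ> q) = c * ga_mult n f g \<sigma>"
  unfolding ga_mult_def using assms
  by (simp add: sum_distrib_left o_assoc mult.left_commute)

lemma e_left: "p \<in> P \<Longrightarrow> e (p \<circ> \<sigma>) = e \<sigma>"
  unfolding e_def by (rule mult_left_invariant) (simp_all add: a_left stab_Sym)

lemma e_right: "q \<in> Q \<Longrightarrow> e (\<sigma> \<circ> q) = of_int (sign q) * e \<sigma>"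
  unfolding e_def by (rule mult_right_invariant) (rule b_right)

text \<open>As \<open>P\<close> and \<open>Q\<close> meet only in the identity, \<open>id\<close>
  factors in just one way. This normalizes the bi-invariant functions below and gives the character
  degree as \<open>fact n / c\<close>.\<close>

lemma e_id: "e id = 1"
proof -
  have "s \<in> P \<and> inv s \<in> Q \<longleftrightarrow> s = id" if "s \<in> Sym n" for s
    using that P_Int_Q[of s] stab_inv[of "inv s"] id_stab by (auto simp: inv_id)
  then have "e id = (\<Sum>s\<in>Sym n. if s = id then 1 else 0)"
    unfolding e_expand by (intro sum.cong) (auto simp: inv_id)
  then show ?thesis by simp
qed

lemma e_in_group_algebra: "e \<in> group_algebra n"
  unfolding e_def by (rule ga_mult_in_group_algebra) (auto simp: group_algebra_def stab_Sym)

section \<open>Factoring permutations through the row and column groups\<close>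

lemma card_row_less: 
  assumes "i < L" shows "card {w \<in> {1..n}. row w = i \<and> col w < j} = min (len i) j"
proof -
  have "bij_betw col {w \<in> {1..n}. row w = i \<and> col w < j} {..<min (len i) j}"
    unfolding bij_betw_def
  proof
    show "inj_on col {w \<in> {1..n}. row w = i \<and> col w < j}"
      by (rule inj_onI) (auto intro!: box_eq)
    show "col ` {w \<in> {1..n}. row w = i \<and> col w < j} = {..<min (len i) j}"
    proof (intro equalityI subsetI)
      fix y assume "y \<in> col ` {w \<in> {1..n}. row w = i \<and> col w < j}"
      then obtain w where "w \<in> {1..n}" "row w = i" "col w < j" "y = col w" by blast
      then show "y \<in> {..<min (len i) j}" using row_col_less[of w] by simp
    next
      fix y assume "y \<in> {..<min (len i) j}"
      then obtain w where "w \<in> {1..n}" "row w = i" "col w = y" using ex_box[OF assms, of y] by auto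
      then show "y \<in> col ` {w \<in> {1..n}. row w = i \<and> col w < j}"
        using \<open>y \<in> {..<min (len i) j}\<close> by force
    qed
  qed
  from bij_betw_same_card[OF this] show ?thesis by simp
qed

text \<open>A $0$-$1$ matrix with the row and column sums of the diagram is the diagram itself: its
  first \<open>j\<close> columns meet row \<open>i\<close> in at most \<open>min (len i) j\<close> ones, and the column sums force
  equality for all \<open>i\<close> and \<open>j\<close>.\<close>

lemma card_twisted_row_less:
  assumes g: "g \<in> Sym n" and i: "i < L"
    and inj: "inj_on (\<lambda>w. (row (g w), col w)) {1..n}"
  shows "card {w \<in> {1..n}. row (g w) = i \<and> col w < j} = min (len i) j"
proof -
  have part: "card {w \<in> {1..n}. col w < j} = (\<Sum>i<L. card {w \<in> {1..n}. \<rho> w = i \<and> col w < j})"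
    if "\<And>w. w \<in> {1..n} \<Longrightarrow> \<rho> w < L" for \<rho>
  proof -
    have "{w \<in> {1..n}. col w < j} = (\<Union>i<L. {w \<in> {1..n}. \<rho> w = i \<and> col w < j})"
      using that by auto
    then show ?thesis by (simp only:) (subst card_UN_disjoint; auto)
  qed
  have gr: "g w \<in> {1..n}" if "w \<in> {1..n}" for w using that Sym_in_range[OF g] by blast
  have gL: "row (g w) < L" if "w \<in> {1..n}" for w using row_col_less gr[OF that] by blast
  have le: "card {w \<in> {1..n}. row (g w) = i \<and> col w < j} \<le> min (len i) j" if "i < L" for i
  proof -
    \<comment> \<open>Two bounds: the columns of these entries are distinct and below
      \<open>j\<close>, and \<open>g\<close> injects the entries into row \<open>i\<close> of the
      diagram.\<close>
    have "card {w \<in> {1..n}. row (g w) = i \<and> col w < j} \<le> card {..<j}"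
    proof (rule card_inj_on_le)
      show "inj_on col {w \<in> {1..n}. row (g w) = i \<and> col w < j}"
        using inj by (rule inj_on_pair_fibre)
    qed auto
    moreover have "card {w \<in> {1..n}. row (g w) = i \<and> col w < j}
        \<le> card {w \<in> {1..n}. row w = i \<and> col w < len i}"
    proof (rule card_inj_on_le)
      show "inj_on g {w \<in> {1..n}. row (g w) = i \<and> col w < j}"
        using g by (auto simp: Sym_def intro: permutes_inj_on)
      show "g ` {w \<in> {1..n}. row (g w) = i \<and> col w < j} \<subseteq> {w \<in> {1..n}. row w = i \<and> col w < len i}"
        using gr row_col_less by blast
    qed simp
    ultimately show ?thesis using card_row_less[OF that, of "len i"] by simp
  qed
  have "(\<Sum>i<L. card {w \<in> {1..n}. row (g w) = i \<and> col w < j}) = card {w \<in> {1..n}. col w < j}"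
    by (rule part[OF gL, symmetric])
  also have "\<dots> = (\<Sum>i<L. card {w \<in> {1..n}. row w = i \<and> col w < j})"
    using row_col_less by (intro part) blast
  also have "\<dots> = (\<Sum>i<L. min (len i) j)"
    by (intro sum.cong refl) (simp only: card_row_less lessThan_iff)
  finally have eq: "(\<Sum>i<L. card {w \<in> {1..n}. row (g w) = i \<and> col w < j}) = (\<Sum>i<L. min (len i) j)" .
  show ?thesis by (rule sum_mono_inv[OF eq]) (use le i in auto)
qed

text \<open>The hypothesis says that no two entries of one column are sent by \<open>g\<close> into
  one row. Then for each entry \<open>z\<close> the column of \<open>z\<close> contains some
  \<open>w\<close> that \<open>g\<close> sends into the row of \<open>z\<close>. Sending
  \<open>z\<close> to \<open>w\<close> defines \<open>q\<close> in \<open>Q\<close>, and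
  \<open>g \<circ> q\<close> preserves rows.\<close>

lemma factorization:
  assumes g: "g \<in> Sym n" and inj: "inj_on (\<lambda>w. (row (g w), col w)) {1..n}"
  shows "\<exists>p\<in>P. \<exists>q\<in>Q. g = p \<circ> q"
proof -
  have gr: "g w \<in> {1..n} \<longleftrightarrow> w \<in> {1..n}" for w using Sym_in_range[OF g] .
  have "\<exists>w\<in>{1..n}. row (g w) = row z \<and> col w = col z" if z: "z \<in> {1..n}" for z
  proof -
    let ?A = "{w \<in> {1..n}. row (g w) = row z \<and> col w < Suc (col z)}"
    have rz: "row z < L" "col z < len (row z)" using row_col_less[OF z] by auto
    have "inj_on col ?A" using inj by (rule inj_on_pair_fibre)
    \<comment> \<open>With the bound \<open>Suc (col z)\<close> the minimum is
      \<open>Suc (col z)\<close>, so all columns up to and including \<open>col z\<close> occur in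
      \<open>?A\<close>.\<close>
    then have "card (col ` ?A) = card {..<Suc (col z)}"
      using card_twisted_row_less[OF g rz(1) inj, of "Suc (col z)"] rz by (simp add: card_image)
    then have "col ` ?A = {..<Suc (col z)}"
      by (intro card_subset_eq) auto
    then have "col z \<in> col ` ?A" by simp
    then show ?thesis by auto
  qed
  then obtain q0 where q0: "\<And>z. z \<in> {1..n} \<Longrightarrow> q0 z \<in> {1..n} \<and> row (g (q0 z)) = row z \<and> col (q0 z) = col z"
    by metis
  define q where "q = (\<lambda>z. if z \<in> {1..n} then q0 z else z)"
  have qz: "q z \<in> {1..n}" "row (g (q z)) = row z" "col (q z) = col z" if "z \<in> {1..n}" for z
    using q0[OF that] that by (simp_all only: q_def if_True)
  have "inj_on q {1..n}"
  proof (rule inj_onI)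
    fix z z' assume z: "z \<in> {1..n}" "z' \<in> {1..n}" and eq: "q z = q z'"
    show "z = z'"
      by (rule box_eq[OF z]) (metis qz(2,3) z eq)+
  qed
  moreover have "q \<in> {1..n} \<rightarrow> {1..n}" using qz(1) by blast
  moreover have "q z = z" if "z \<notin> {1..n}" for z using that by (simp only: q_def if_False)
  ultimately have "q permutes {1..n}" by (intro inj_imp_permutes) auto
  then have q: "q \<in> Q" using qz by (simp add: stab_def Sym_def)
  have "g \<circ> q \<in> P"
    using qz Sym_comp[OF g stab_Sym[OF q]] by (simp add: stab_def)
  moreover have "g = (g \<circ> q) \<circ> inv q" using stab_Sym[OF q] by simp
  ultimately show ?thesis using stab_inv[OF q] by blast
qed

text \<open>Otherwise two entries \<open>x\<close>, \<open>y\<close> of one column have images in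
  one row; conjugation by \<open>g\<close> carries the transposition of \<open>x\<close> and
  \<open>y\<close> to that of their images.\<close>

lemma transposition_or_factorization:
  assumes g: "g \<in> Sym n" and nf: "\<not> (\<exists>p\<in>P. \<exists>q\<in>Q. g = p \<circ> q)"
  shows "\<exists>p\<in>P. \<exists>q\<in>Q. p \<circ> g = g \<circ> q \<and> sign q = -1"
proof -
  from nf factorization[OF g] have "\<not> inj_on (\<lambda>w. (row (g w), col w)) {1..n}" by blast
  then obtain x y where xy: "x \<in> {1..n}" "y \<in> {1..n}" "x \<noteq> y"
    "row (g x) = row (g y)" "col x = col y"
    unfolding inj_on_def by blast
  define p where "p = transpose (g x) (g y)"
  define q where "q = transpose x y"
  have gr: "g w \<in> {1..n} \<longleftrightarrow> w \<in> {1..n}" for w using Sym_in_range[OF g] .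
  have "p \<in> P" unfolding p_def using xy gr by (intro transpose_stab) auto
  moreover have "q \<in> Q" unfolding q_def using xy by (intro transpose_stab)
  moreover have "p \<circ> g = g \<circ> q"
    using g by (auto simp: p_def q_def fun_eq_iff transpose_def Sym_def dest: permutes_inj injD)
  moreover have "sign q = -1" using xy by (simp add: q_def sign_swap_id)
  ultimately show ?thesis by blast
qed

text \<open>The classical uniqueness argument for Young symmetrizers: on products of
  \<open>P\<close> and \<open>Q\<close> the invariance fixes the values from the one at
  \<open>id\<close>, and at any other permutation a transposition gives
  \<open>x \<sigma> = - x \<sigma>\<close>.\<close>

lemma bi_invariant_unique:
  assumes x: "x \<in> group_algebra n"
    and l: "\<And>p \<sigma>. p \<in> P \<Longrightarrow> \<sigma> \<in> Sym n \<Longrightarrow> x (p \<circ> \<sigma>) = x \<sigma>"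
    and r: "\<And>q \<sigma>. q \<in> Q \<Longrightarrow> \<sigma> \<in> Sym n \<Longrightarrow> x (\<sigma> \<circ> q) = of_int (sign q) * x \<sigma>"
  shows "x = (\<lambda>\<sigma>. x id * e \<sigma>)"
proof
  fix \<sigma>
  consider "\<sigma> \<notin> Sym n" | (pq) p q where "p \<in> P" "q \<in> Q" "\<sigma> = p \<circ> q"
    | (swap) p q where "\<sigma> \<in> Sym n" "p \<in> P" "q \<in> Q" "p \<circ> \<sigma> = \<sigma> \<circ> q" "sign q = -1"
    using transposition_or_factorization by blast
  then show "x \<sigma> = x id * e \<sigma>"
  proof cases
    case 1
    then show ?thesis using x e_in_group_algebra by (auto simp: group_algebra_def)
  next
    case pq
    then show ?thesis using l[of p q] r[of q id] e_left[of p q] e_right[of q id] e_id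
      by (auto simp: stab_Sym)
  next
    case swap
    have "x \<sigma> = - x \<sigma>" "e \<sigma> = - e \<sigma>"
      using l[OF swap(2,1)] r[OF swap(3,1)] e_left[OF swap(2), of \<sigma>] e_right[OF swap(3), of \<sigma>] swap
      by simp_all
    then show ?thesis by simp
  qed
qed

section \<open>The square of the Young symmetrizer\<close>

lemma a_star: "\<sigma> \<in> Sym n \<Longrightarrow> ga_star a \<sigma> = a \<sigma>"
  using stab_inv[of \<sigma>] stab_inv[of "inv \<sigma>"] by (auto simp: ga_star_def)

lemma b_star: "\<sigma> \<in> Sym n \<Longrightarrow> ga_star b \<sigma> = b \<sigma>"
  using stab_inv[of \<sigma>] stab_inv[of "inv \<sigma>"] by (auto simp: ga_star_def sign_inverse Sym_permutation)

lemma a_a: "ga_mult n a a = (\<lambda>\<sigma>. of_nat (card P) * a \<sigma>)"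
proof
  fix \<sigma>
  have "ga_mult n a a \<sigma> = (\<Sum>\<tau>\<in>Sym n. if \<tau> \<in> P then a \<sigma> else 0)"
    unfolding ga_mult_def by (intro sum.cong) (auto simp: stab_left_iff stab_inv)
  also have "\<dots> = (\<Sum>\<tau>\<in>P. a \<sigma>)"
    by (intro sum.mono_neutral_cong_right) (auto simp: stab_Sym)
  finally show "ga_mult n a a \<sigma> = of_nat (card P) * a \<sigma>" by simp
qed

lemma b_b: "ga_mult n b b = (\<lambda>\<sigma>. of_nat (card Q) * b \<sigma>)"
proof
  fix \<sigma>
  have "ga_mult n b b \<sigma> = (\<Sum>\<tau>\<in>Sym n. if \<tau> \<in> Q then b \<sigma> else 0)"
    unfolding ga_mult_def
  proof (intro sum.cong refl)
    fix \<tau> assume "\<tau> \<in> Sym n"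
    have "sign \<tau> * sign (inv \<tau>) = 1"
      using \<open>\<tau> \<in> Sym n\<close> by (simp add: sign_inverse Sym_permutation)
    then show "b \<tau> * b (inv \<tau> \<circ> \<sigma>) = (if \<tau> \<in> Q then b \<sigma> else 0)"
      by (auto simp: stab_left_iff stab_inv sign_comp stab_Sym Sym_inv
          simp flip: of_int_mult mult.assoc)
  qed
  also have "\<dots> = (\<Sum>\<tau>\<in>Q. b \<sigma>)"
    by (intro sum.mono_neutral_cong_right) (auto simp: stab_Sym)
  finally show "ga_mult n b b \<sigma> = of_nat (card Q) * b \<sigma>" by simp
qed

lemma mult_zero: "ga_mult n 0 f = 0" "ga_mult n f 0 = 0"
  by (auto simp: ga_mult_def fun_eq_iff)

text \<open>If \<open>abab = 0\<close>, then \<open>(aba)(aba)\<^sup>* = |P| ababa = 0\<close>, so \<open>aba = 0\<close>; then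
  \<open>(ab)(ab)\<^sup>* = |Q| aba = 0\<close>, so \<open>ab = 0\<close>.\<close>

lemma e_e_nonzero: "ga_mult n e e \<noteq> 0"
proof
  assume 0: "ga_mult n e e = 0"
  let ?m = "ga_mult n"
  have ag: "a \<in> group_algebra n" "b \<in> group_algebra n" by (auto simp: group_algebra_def stab_Sym)
  have es: "ga_star e \<sigma> = ?m b a \<sigma>" if "\<sigma> \<in> Sym n" for \<sigma>
    using that unfolding e_def
    by (subst ga_star_mult) (auto intro!: ga_mult_cong a_star b_star)
  have "ga_star (?m e a) \<sigma> = ?m a (?m b a) \<sigma>" if "\<sigma> \<in> Sym n" for \<sigma>
    using that by (subst ga_star_mult) (auto intro!: ga_mult_cong a_star es)
  then have "?m (?m e a) (ga_star (?m e a)) id = ?m (?m e a) (?m a (?m b a)) id"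
    by (intro ga_mult_cong) auto
  also have "?m (?m e a) (?m a (?m b a)) = ?m e (?m (?m a a) (?m b a))"
    by (simp only: ga_mult_assoc)
  also have "\<dots> = (\<lambda>\<sigma>. of_nat (card P) * ?m (?m e e) a \<sigma>)"
    by (simp only: a_a ga_mult_scale_left ga_mult_scale_right) (simp only: e_def ga_mult_assoc)
  also have "\<dots> id = 0" by (simp add: 0 mult_zero)
  finally have "?m e a = 0"
    by (intro ga_star_pos) (simp_all only: ga_mult_in_group_algebra ag)
  have "?m e (ga_star e) id = ?m e (?m b a) id"
    using es by (intro ga_mult_cong) auto
  also have "?m e (?m b a) = ?m a (?m (?m b b) a)"
    by (simp only: ga_mult_assoc e_def)
  also have "\<dots> = (\<lambda>\<sigma>. of_nat (card Q) * ?m e a \<sigma>)"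
    by (simp only: b_b ga_mult_scale_left ga_mult_scale_right) (simp only: e_def ga_mult_assoc)
  also have "\<dots> id = 0" by (simp add: \<open>?m e a = 0\<close>)
  finally have "e = 0" by (rule ga_star_pos[OF e_in_group_algebra])
  then show False using e_id by simp
qed

text \<open>The square inherits left invariance under \<open>P\<close> from its first factor and the
  sign rule under \<open>Q\<close> from its last, hence is a multiple of \<open>e\<close>; the
  scalar is its coefficient at \<open>id\<close>.\<close>

lemma e_quasi_idempotent: "\<exists>c. c \<noteq> 0 \<and> ga_mult n e e = (\<lambda>\<sigma>. c * e \<sigma>)"
proof -
  have *: "ga_mult n e e = (\<lambda>\<sigma>. ga_mult n e e id * e \<sigma>)"
    by (intro bi_invariant_unique mult_left_invariant mult_right_invariant
        ga_mult_in_group_algebra e_in_group_algebra)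
       (auto simp: e_left e_right stab_Sym)
  moreover have "ga_mult n e e id \<noteq> 0"
    using e_e_nonzero * by (metis (no_types, lifting) ext mult_zero_left zero_fun_apply)
  ultimately show ?thesis by blast
qed

end

lemma diagram_boxes:
  fixes \<omega> :: "nat multiset"
  defines "r \<equiv> rev (sorted_list_of_multiset \<omega>)"
  shows "diagram (\<Sum>\<^sub># \<omega>) (length r) (\<lambda>i. r ! i) (\<lambda>x. fst (box_of \<omega> x)) (\<lambda>x. snd (box_of \<omega> x))"
proof
  have bx: "boxes \<omega> = concat (map (\<lambda>i. map (\<lambda>j. (i, j)) [0..<r ! i]) [0..<length r])"
    by (simp add: boxes_def r_def Let_def)
  have set: "set (boxes \<omega>) = {(i, j). i < length r \<and> j < r ! i}"
    by (auto simp: bx)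
  have "distinct (boxes \<omega>)"
  proof -
    have "distinct (concat (map (\<lambda>i. map (\<lambda>j. (i, j)) [0..<r ! i]) [0..<m]))" for m
      by (induction m) (auto simp: distinct_map inj_on_def)
    then show ?thesis by (simp only: bx)
  qed
  have "length (boxes \<omega>) = sum_list (map (\<lambda>i. r ! i) [0..<length r])"
    by (simp add: bx length_concat comp_def)
  also have "\<dots> = sum_list r" by (simp add: map_nth)
  also have "\<dots> = \<Sum>\<^sub># \<omega>" by (metis mset_rev mset_sorted_list_of_multiset r_def sum_mset_sum_list)
  finally have len: "length (boxes \<omega>) = \<Sum>\<^sub># \<omega>" .
  \<comment> \<open>Entries are numbered from 1, list positions from 0.\<close>
  have "bij_betw (\<lambda>x. x - 1) {1..\<Sum>\<^sub># \<omega>} {..<\<Sum>\<^sub># \<omega>}"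
    by (rule bij_betwI[of _ _ _ Suc]) auto
  then have "bij_betw ((\<lambda>i. boxes \<omega> ! i) \<circ> (\<lambda>x. x - 1)) {1..\<Sum>\<^sub># \<omega>} (set (boxes \<omega>))"
    using bij_betw_nth[OF \<open>distinct (boxes \<omega>)\<close>] len by (intro bij_betw_trans) auto
  then show "bij_betw (\<lambda>x. (fst (box_of \<omega> x), snd (box_of \<omega> x))) {1..\<Sum>\<^sub># \<omega>}
     {(i, j). i < length r \<and> j < r ! i}"
    by (simp add: set box_of_def comp_def)
qed

text \<open>The scalar \<open>c\<close> depends on \<open>\<omega>\<close> alone, so it cancels from
  every ratio of character values and its value is never computed.\<close>

lemma irr_char_perm_formula:
  fixes \<omega> :: "nat multiset"
  defines "n \<equiv> \<Sum>\<^sub># \<omega>"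
  shows "\<exists>c. c \<noteq> 0 \<and> (\<forall>\<pi>\<in>Sym n. irr_char_perm \<omega> \<pi>
     = (\<Sum>g\<in>Sym n. young_symmetrizer \<omega> (inv g \<circ> inv \<pi> \<circ> g)) / c)"
proof -
  define r where "r = rev (sorted_list_of_multiset \<omega>)"
  interpret diagram n "length r" "\<lambda>i. r ! i" "\<lambda>x. fst (box_of \<omega> x)" "\<lambda>x. snd (box_of \<omega> x)"
    unfolding n_def r_def by (rule diagram_boxes)
  have e: "young_symmetrizer \<omega> = e"
    unfolding e_def young_symmetrizer_def row_group_def col_group_def stab_def
    unfolding n_def by (rule refl)
  obtain c where c: "c \<noteq> 0" "ga_mult n e e = (\<lambda>\<sigma>. c * e \<sigma>)" using e_quasi_idempotent by blast
  then show ?thesis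
    unfolding irr_char_perm_def irr_module_def n_def[symmetric] e
    using trace_left_ideal[OF e_in_group_algebra c(2,1)] by blast
qed

subsection \<open>Cycles\<close>

lemma Sym_out: "\<sigma> \<in> Sym n \<Longrightarrow> x \<notin> {1..n} \<Longrightarrow> \<sigma> x = x"
  unfolding Sym_def by (auto dest: permutes_not_in)

lemma Sym_inj: "\<sigma> \<in> Sym n \<Longrightarrow> inj \<sigma>"
  unfolding Sym_def by (auto intro: permutes_inj)

lemma self_in_orbit: "\<sigma> \<in> Sym n \<Longrightarrow> x \<in> orbit \<sigma> x"
  by (rule permutation_self_in_orbit[OF Sym_permutation])

lemma orbit_subset_range: "\<sigma> \<in> Sym n \<Longrightarrow> x \<in> {1..n} \<Longrightarrow> orbit \<sigma> x \<subseteq> {1..n}"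
  unfolding Sym_def by (auto dest: permutes_orbit_subset)

lemma orbit_eq: "\<sigma> \<in> Sym n \<Longrightarrow> y \<in> orbit \<sigma> x \<Longrightarrow> orbit \<sigma> y = orbit \<sigma> x"
  by (rule orbit_cyclic_eq3[OF cyclic_on_orbit'[OF Sym_permutation]])

lemma orbit_invariant:
  assumes "\<And>x. x \<in> A \<Longrightarrow> f (\<sigma> x) = f x" "\<And>x. x \<in> A \<Longrightarrow> \<sigma> x \<in> A" "x \<in> A" "y \<in> orbit \<sigma> x"
  shows "f y = f x"
proof -
  from assms(4) have "y \<in> A \<and> f y = f x"
    by (induction rule: orbit.induct) (use assms in auto)
  then show ?thesis ..
qed

lemma orbit_inv: "\<sigma> \<in> Sym n \<Longrightarrow> orbit (inv \<sigma>) x = orbit \<sigma> x"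
  by (rule orbit_inv_eq[OF Sym_permutation])

lemma cycles_inv: "\<sigma> \<in> Sym n \<Longrightarrow> cycles k (inv \<sigma>) = cycles k \<sigma>"
  by (simp add: cycles_def orbit_inv)

lemma finite_cycles [simp]: "finite (cycles n \<sigma>)"
  by (simp add: cycles_def)

lemma in_cycles_iff: "\<sigma> \<in> Sym n \<Longrightarrow> u \<in> cycles n \<sigma> \<Longrightarrow> x \<in> u \<Longrightarrow> x \<in> {1..n} \<and> u = orbit \<sigma> x"
  using orbit_subset_range orbit_eq by (fastforce simp only: cycles_def)

lemma orbit_in_cycles: "x \<in> {1..n} \<Longrightarrow> orbit \<sigma> x \<in> cycles n \<sigma>"
  by (simp only: cycles_def imageI)

lemma cycles_nonempty: "\<sigma> \<in> Sym n \<Longrightarrow> u \<in> cycles n \<sigma> \<Longrightarrow> \<exists>x. x \<in> u"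
  using self_in_orbit by (fastforce simp only: cycles_def)

section \<open>Cycle counts, sign and the triangle inequality\<close>

lemma num_cycles_le: "num_cycles n \<sigma> \<le> n"
  unfolding num_cycles_def cycles_def using card_image_le[of "{1..n}"] by simp

lemma orbit_id: "orbit id x = {x}"
  by (simp add: orbit_eq_singleton_iff)

lemma num_cycles_id: "num_cycles n id = n"
  by (simp add: num_cycles_def cycles_def orbit_id card_image)

text \<open>The cycles of the product that contain neither \<open>a\<close> nor \<open>b\<close> are cycles of \<open>\<sigma>\<close>.\<close>

lemma num_cycles_transpose_le:
  assumes \<sigma>: "\<sigma> \<in> Sym n" and ab: "a \<in> {1..n}" "b \<in> {1..n}"
  shows "num_cycles n (transpose a b \<circ> \<sigma>) \<le> Suc (num_cycles n \<sigma>)"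
proof -
  let ?\<tau> = "transpose a b \<circ> \<sigma>"
  have \<tau>: "?\<tau> \<in> Sym n" by (intro Sym_comp \<sigma>) (use ab in \<open>auto simp: Sym_def intro: permutes_swap_id\<close>)
  have "cycles n ?\<tau> - {orbit ?\<tau> a, orbit ?\<tau> b} \<subseteq> cycles n \<sigma> - {orbit \<sigma> a}"
  proof
    fix u assume u: "u \<in> cycles n ?\<tau> - {orbit ?\<tau> a, orbit ?\<tau> b}"
    then obtain x where x: "x \<in> {1..n}" "u = orbit ?\<tau> x" by (auto simp only: cycles_def)
    have nab: "a \<notin> u" "b \<notin> u" using u x orbit_eq[OF \<tau>] by auto
    have "y \<in> orbit ?\<tau> x \<Longrightarrow> ?\<tau> y = \<sigma> y" for y
      using orbit.step[of y ?\<tau> x] nab x by (auto simp: transpose_def split: if_splits)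
    then have "orbit ?\<tau> x = orbit \<sigma> x"
      by (intro orbit_cong0[of x "orbit ?\<tau> x"]) (auto intro: self_in_orbit[OF \<tau>] orbit.step)
    then show "u \<in> cycles n \<sigma> - {orbit \<sigma> a}"
      using x nab self_in_orbit[OF \<sigma>, of a] orbit_in_cycles by auto
  qed
  \<comment> \<open>At most two cycles of the product are dropped, and the cycle of \<open>a\<close>
    under \<open>\<sigma>\<close> is never among the rest, so the gain is at most one.\<close>
  then have "card (cycles n ?\<tau> - {orbit ?\<tau> a, orbit ?\<tau> b}) \<le> card (cycles n \<sigma> - {orbit \<sigma> a})"
    by (intro card_mono) auto
  moreover have "card (cycles n \<sigma> - {orbit \<sigma> a}) = num_cycles n \<sigma> - 1" "num_cycles n \<sigma> > 0"
    using orbit_in_cycles[OF ab(1), of \<sigma>] by (auto simp: num_cycles_def card_gt_0_iff)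
  moreover have "card (cycles n ?\<tau>) - card {orbit ?\<tau> a, orbit ?\<tau> b}
      \<le> card (cycles n ?\<tau> - {orbit ?\<tau> a, orbit ?\<tau> b})"
    by (rule diff_card_le_card_Diff) simp
  moreover have "card {orbit ?\<tau> a, orbit ?\<tau> b} \<le> 2"
    by (simp add: card_insert_if)
  ultimately show ?thesis by (simp add: num_cycles_def)
qed

text \<open>The product fixes \<open>x\<close>: the point \<open>x\<close> is cut out of its cycle,
  and the remainder of that cycle closes up. The upper bound is
  \<open>num_cycles_transpose_le\<close>; for the lower one the cycles other than \<open>{x}\<close>
  are mapped onto the cycles of \<open>\<sigma>\<close>.\<close>

lemma num_cycles_split:
  assumes \<sigma>: "\<sigma> \<in> Sym n" and x: "x \<in> {1..n}" "\<sigma> x \<noteq> x"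
  shows "num_cycles n (transpose x (\<sigma> x) \<circ> \<sigma>) = Suc (num_cycles n \<sigma>)"
proof (rule antisym)
  let ?\<tau> = "transpose x (\<sigma> x) \<circ> \<sigma>"
  have \<sigma>x: "\<sigma> x \<in> {1..n}" using x Sym_in_range[OF \<sigma>] by blast
  show "num_cycles n ?\<tau> \<le> Suc (num_cycles n \<sigma>)"
    by (rule num_cycles_transpose_le[OF \<sigma> x(1) \<sigma>x])
  have \<tau>: "?\<tau> \<in> Sym n"
    by (intro Sym_comp \<sigma>) (use x \<sigma>x in \<open>auto simp: Sym_def intro: permutes_swap_id\<close>)
  have step: "?\<tau> y \<in> orbit \<sigma> y" for y
  proof -
    have "y \<in> orbit \<sigma> y" "\<sigma> y \<in> orbit \<sigma> y" "\<sigma> (\<sigma> y) \<in> orbit \<sigma> y"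
      by (auto intro: self_in_orbit[OF \<sigma>] orbit.intros)
    moreover have "\<sigma> y = \<sigma> x \<longleftrightarrow> y = x" using Sym_inj[OF \<sigma>] by (auto dest: injD)
    ultimately show ?thesis by (auto simp: transpose_def)
  qed
  have orb: "orbit \<sigma> z = orbit \<sigma> y" if "z \<in> orbit ?\<tau> y" for y z
    using that by (induction rule: orbit.induct) (use step orbit_eq[OF \<sigma>] in blast)+
  \<comment> \<open>Orbits of the product refine those of \<open>\<sigma>\<close>, so
    \<open>h\<close> sends each cycle to the cycle of \<open>\<sigma>\<close> around it, whichever
    element is picked.\<close>
  define h where "h = (\<lambda>w. orbit \<sigma> (SOME y. y \<in> w))"
  have h: "h (orbit ?\<tau> y) = orbit \<sigma> y" for y
    unfolding h_def
    by (rule orb) (rule someI[of "\<lambda>z. z \<in> orbit ?\<tau> y", OF self_in_orbit[OF \<tau>]])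
  have "orbit ?\<tau> x = {x}" by (simp add: orbit_eq_singleton_iff)
  then have ne: "orbit ?\<tau> x \<noteq> orbit ?\<tau> (\<sigma> x)"
    using self_in_orbit[OF \<tau>, of "\<sigma> x"] x by auto
  have "cycles n \<sigma> \<subseteq> h ` (cycles n ?\<tau> - {orbit ?\<tau> x})"
  proof
    fix u assume "u \<in> cycles n \<sigma>"
    then obtain y where y: "y \<in> {1..n}" "u = orbit \<sigma> y" by (auto simp only: cycles_def)
    show "u \<in> h ` (cycles n ?\<tau> - {orbit ?\<tau> x})"
    proof (cases "orbit ?\<tau> y = orbit ?\<tau> x")
      case True
      \<comment> \<open>The cycle of \<open>x\<close> is still hit after \<open>{x}\<close> is
        removed, namely from the orbit of \<open>\<sigma> x\<close>.\<close>
      have "orbit \<sigma> (\<sigma> x) = orbit \<sigma> x" by (rule orbit_eq[OF \<sigma>]) (rule orbit.base)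
      then have "u = h (orbit ?\<tau> (\<sigma> x))" using h[of y] h[of x] h[of "\<sigma> x"] y True by simp
      then show ?thesis using ne orbit_in_cycles[OF \<sigma>x] by blast
    next
      case False
      then show ?thesis using h[of y] y orbit_in_cycles by blast
    qed
  qed
  then have "card (cycles n \<sigma>) \<le> card (cycles n ?\<tau> - {orbit ?\<tau> x})"
    by (rule surj_card_le[rotated]) simp
  then show "Suc (num_cycles n \<sigma>) \<le> num_cycles n ?\<tau>"
    using orbit_in_cycles[OF x(1), of ?\<tau>]
    by (simp add: num_cycles_def) (metis Suc_pred card_gt_0_iff emptyE finite_cycles not_less_eq_eq Suc_le_mono)
qed

text \<open>\<open>n - num_cycles n \<sigma>\<close> is the length of \<open>\<sigma>\<close> in
  transpositions; the second part is the triangle inequality for it. One induction serves both: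
  splitting off a moved point lowers the length by one, flips the sign, and changes the count for
  \<open>\<sigma> \<circ> \<beta>\<close> by at most one upwards.\<close>

lemma sign_and_num_cycles:
  assumes "\<sigma> \<in> Sym n"
  shows "sign \<sigma> = (-1) ^ (n - num_cycles n \<sigma>) \<and>
    (\<forall>\<beta>\<in>Sym n. num_cycles n \<beta> \<le> num_cycles n (\<sigma> \<circ> \<beta>) + (n - num_cycles n \<sigma>))"
  using assms
proof (induction "n - num_cycles n \<sigma>" arbitrary: \<sigma> rule: less_induct)
  case less
  show ?case
  proof (cases "\<sigma> = id")
    case True
    then show ?thesis by (simp add: num_cycles_id)
  next
    case False
    then obtain x where x: "\<sigma> x \<noteq> x" by (auto simp: fun_eq_iff)
    then have xn: "x \<in> {1..n}" using Sym_out[OF less.prems] by blast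
    then have \<sigma>x: "\<sigma> x \<in> {1..n}" using Sym_in_range[OF less.prems] by blast
    let ?t = "transpose x (\<sigma> x)"
    have t: "?t \<in> Sym n" using xn \<sigma>x by (auto simp: Sym_def intro: permutes_swap_id)
    have \<tau>: "?t \<circ> \<sigma> \<in> Sym n" by (rule Sym_comp[OF t less.prems])
    have eq: "num_cycles n (?t \<circ> \<sigma>) = Suc (num_cycles n \<sigma>)"
      by (rule num_cycles_split[OF less.prems xn x])
    then have lt: "num_cycles n \<sigma> < n" using num_cycles_le[of n "?t \<circ> \<sigma>"] by simp
    have ns: "n - num_cycles n \<sigma> = Suc (n - num_cycles n (?t \<circ> \<sigma>))" using eq lt by simp
    from less.hyps[OF _ \<tau>] ns have IH: "sign (?t \<circ> \<sigma>) = (-1) ^ (n - num_cycles n (?t \<circ> \<sigma>))"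
      "\<And>\<beta>. \<beta> \<in> Sym n \<Longrightarrow> num_cycles n \<beta> \<le> num_cycles n (?t \<circ> \<sigma> \<circ> \<beta>) + (n - num_cycles n (?t \<circ> \<sigma>))"
      by auto
    have "sign (?t \<circ> \<sigma>) = - sign \<sigma>"
      using x t less.prems by (simp add: sign_compose Sym_permutation sign_swap_id)
    then have "sign \<sigma> = (-1) ^ (n - num_cycles n \<sigma>)" using IH(1) ns by simp
    moreover have "num_cycles n \<beta> \<le> num_cycles n (\<sigma> \<circ> \<beta>) + (n - num_cycles n \<sigma>)" if "\<beta> \<in> Sym n" for \<beta>
      using IH(2)[OF that] num_cycles_transpose_le[OF Sym_comp[OF less.prems that] xn \<sigma>x] ns
      by (simp add: comp_assoc)
    ultimately show ?thesis by blast
  qed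
qed

lemma sign_num_cycles: "\<sigma> \<in> Sym n \<Longrightarrow> sign \<sigma> = (-1) ^ (n - num_cycles n \<sigma>)"
  using sign_and_num_cycles by blast

text \<open>The triangle inequality for the factorization of \<open>\<beta>\<close> into
  \<open>inv \<alpha>\<close> and \<open>\<alpha> \<circ> \<beta>\<close>. It bounds the degrees in
  the coloured sum.\<close>

lemma num_cycles_mult_le:
  assumes "\<alpha> \<in> Sym n" "\<beta> \<in> Sym n"
  shows "num_cycles n \<alpha> + num_cycles n (\<alpha> \<circ> \<beta>) \<le> n + num_cycles n \<beta>"
proof -
  have "num_cycles n (inv \<alpha>) = num_cycles n \<alpha>" using assms by (simp add: num_cycles_def cycles_inv)
  moreover have "inv \<alpha> \<circ> (\<alpha> \<circ> \<beta>) = \<beta>" using assms by simp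
  ultimately show ?thesis
    using sign_and_num_cycles[OF Sym_inv[OF assms(1)]] Sym_comp[OF assms] num_cycles_le[of n \<alpha>]
    by fastforce
qed

section \<open>Cycle types and conjugacy\<close>

lemma Sym_mono: "k \<le> n \<Longrightarrow> \<sigma> \<in> Sym k \<Longrightarrow> \<sigma> \<in> Sym n"
  unfolding Sym_def by (auto intro: permutes_subset)

text \<open>The added points are fixed, so a permutation of type \<open>\<mu>\<close> on [k]
  represents, on [n], the class at which the normalized character is taken.\<close>

lemma cycle_type_extend:
  assumes "k \<le> n" "\<sigma> \<in> Sym k"
  shows "cycle_type n \<sigma> = cycle_type k \<sigma> + replicate_mset (n - k) 1"
proof -
  have "{1..n} = {1..k} \<union> {k<..n}" using assms(1) by auto
  moreover have fixed: "orbit \<sigma> x = {x}" if "x \<in> {k<..n}" for x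
    using that Sym_out[OF assms(2), of x] by (simp add: orbit_eq_singleton_iff)
  ultimately have "cycles n \<sigma> = cycles k \<sigma> \<union> (\<lambda>x. {x}) ` {k<..n}"
    by (auto simp add: cycles_def image_Un)
  moreover have "cycles k \<sigma> \<inter> (\<lambda>x. {x}) ` {k<..n} = {}"
    using in_cycles_iff[OF assms(2)] by fastforce
  ultimately have "cycle_type n \<sigma> = cycle_type k \<sigma> + image_mset card (mset_set ((\<lambda>x. {x}) ` {k<..n}))"
    by (simp add: cycle_type_def mset_set_Union)
  also have "mset_set ((\<lambda>x. {x}) ` {k<..n}) = image_mset (\<lambda>x. {x}) (mset_set {k<..n})"
    by (rule image_mset_mset_set[symmetric]) simp
  also have "image_mset card \<dots> = replicate_mset (n - k) 1"
    by (simp add: image_mset.compositionality comp_def image_mset_const_eq)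
  finally show ?thesis .
qed

lemma cycle_type_inv: "\<sigma> \<in> Sym n \<Longrightarrow> cycle_type n (inv \<sigma>) = cycle_type n \<sigma>"
  by (simp add: cycle_type_def cycles_inv)

lemma cycle_type_id: "cycle_type n id = replicate_mset n 1"
proof -
  have "id \<in> Sym 0" by simp
  from cycle_type_extend[OF _ this, of n] show ?thesis by (simp add: cycle_type_def cycles_def)
qed

lemma size_cycle_type: "size (cycle_type n \<sigma>) = num_cycles n \<sigma>"
  by (simp add: cycle_type_def num_cycles_def)

text \<open>Used with \<open>card\<close> for both labellings, where it pairs the cycles of two
  permutations of equal type so that lengths agree.\<close>

lemma image_mset_eq_bij_betw:
  assumes "finite A" "finite B" "image_mset f (mset_set A) = image_mset g (mset_set B)"
  shows "\<exists>h. bij_betw h A B \<and> (\<forall>x\<in>A. g (h x) = f x)"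
  using assms
proof (induction A arbitrary: B rule: finite_induct)
  case empty
  then show ?case by (auto simp: bij_betw_def mset_set_empty_iff)
next
  case (insert a A)
  then have "f a \<in># image_mset g (mset_set B)" by (metis image_mset_add_mset mset_set.insert union_single_eq_member)
  then obtain b where b: "b \<in> B" "g b = f a" using insert.prems by auto
  then have "mset_set B = add_mset b (mset_set (B - {b}))"
    using insert.prems by (metis finite_Diff insert_Diff mset_set.insert Diff_iff insertI1)
  then have "image_mset f (mset_set A) = image_mset g (mset_set (B - {b}))"
    using insert b by simp
  from insert.IH[OF _ this] insert.prems obtain h where
    h: "bij_betw h A (B - {b})" "\<forall>x\<in>A. g (h x) = f x" by auto
  have "bij_betw (h(a := b)) (insert a A) (insert b (B - {b}))"
    using h insert.hyps by (auto simp: bij_betw_def inj_on_def)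
  moreover have "insert b (B - {b}) = B" using b by auto
  moreover have "\<forall>x\<in>insert a A. g ((h(a := b)) x) = f x" using h b insert.hyps by auto
  ultimately show ?case by metis
qed

text \<open>The iterates are periodic with the cycle length and injective over one period.
  Coincidences thus depend only on the length and carry over to any other cycle of that
  length.\<close>

lemma funpow_eq_iff_mod_card_orbit:
  assumes "\<sigma> \<in> Sym n"
  shows "(\<sigma> ^^ i) x = (\<sigma> ^^ j) x \<longleftrightarrow> i mod card (orbit \<sigma> x) = j mod card (orbit \<sigma> x)"
proof -
  let ?c = "funpow_dist1 \<sigma> x x"
  have x: "x \<in> orbit \<sigma> x" by (rule self_in_orbit[OF assms])
  have inj: "inj_on (\<lambda>i. (\<sigma> ^^ i) x) {0..<?c}" by (rule inj_on_funpow_dist1[OF x])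
  have "card (orbit \<sigma> x) = ?c"
    by (subst orbit_conv_funpow_dist1[OF x]) (simp only: card_image[OF inj] card_atLeastLessThan diff_zero)
  moreover have "(\<sigma> ^^ i) x = (\<sigma> ^^ (i mod ?c)) x" for i
    by (rule funpow_mod_eq[symmetric]) (rule funpow_dist1_prop[OF x])
  moreover have "(\<sigma> ^^ (i mod ?c)) x = (\<sigma> ^^ (j mod ?c)) x \<longleftrightarrow> i mod ?c = j mod ?c"
    using inj_on_eq_iff[OF inj, of "i mod ?c" "j mod ?c"] by simp
  ultimately show ?thesis by metis
qed

lemma orbit_funpow: "\<sigma> \<in> Sym n \<Longrightarrow> y \<in> orbit \<sigma> x \<longleftrightarrow> (\<exists>i. y = (\<sigma> ^^ i) x)"
  by (auto simp: orbit_altdef_permutation Sym_permutation)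

text \<open>Cycles of equal length are paired by \<open>h\<close> and given base points; running
  along both cycles in step defines the conjugating permutation.\<close>

lemma conjugate_if_same_cycle_type:
  assumes \<sigma>: "\<sigma> \<in> Sym n" and \<tau>: "\<tau> \<in> Sym n" and eq: "cycle_type n \<sigma> = cycle_type n \<tau>"
  shows "\<exists>g\<in>Sym n. g \<circ> \<sigma> = \<tau> \<circ> g"
proof -
  obtain h where h: "bij_betw h (cycles n \<sigma>) (cycles n \<tau>)" "\<And>u. u \<in> cycles n \<sigma> \<Longrightarrow> card (h u) = card u"
    using image_mset_eq_bij_betw[OF _ _ eq[unfolded cycle_type_def]] by auto
  define a where "a u = (SOME x. x \<in> u)" for u :: "nat set"
  have a: "a u \<in> u \<and> u = orbit \<sigma> (a u)" if "u \<in> cycles n \<sigma>" for u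
    using cycles_nonempty[OF \<sigma> that] in_cycles_iff[OF \<sigma> that] unfolding a_def by (metis someI_ex)
  define b where "b u = a (h u)" for u
  have b: "h u \<in> cycles n \<tau> \<and> b u \<in> h u \<and> h u = orbit \<tau> (b u)" if "u \<in> cycles n \<sigma>" for u
  proof -
    have "h u \<in> cycles n \<tau>" using h(1) that by (rule bij_betw_apply)
    then show ?thesis
      using cycles_nonempty[OF \<tau>] in_cycles_iff[OF \<tau>] unfolding a_def b_def by (metis someI_ex)
  qed
  \<comment> \<open>Both sides say that \<open>i\<close> and \<open>j\<close> agree modulo the
    common cycle length; this makes \<open>g\<close> below well defined and injective on each
    cycle.\<close>
  have wd: "(\<tau> ^^ i) (b u) = (\<tau> ^^ j) (b u) \<longleftrightarrow> (\<sigma> ^^ i) (a u) = (\<sigma> ^^ j) (a u)"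
    if "u \<in> cycles n \<sigma>" for u i j
    using funpow_eq_iff_mod_card_orbit[OF \<tau>, of i "b u" j]
      funpow_eq_iff_mod_card_orbit[OF \<sigma>, of i "a u" j] a[OF that] b[OF that] h(2)[OF that] by metis
  define g where "g x = (if x \<in> {1..n} then
      (\<tau> ^^ (SOME i. x = (\<sigma> ^^ i) (a (orbit \<sigma> x)))) (b (orbit \<sigma> x)) else x)" for x
  have pow: "\<exists>i. x = (\<sigma> ^^ i) (a (orbit \<sigma> x)) \<and> g x = (\<tau> ^^ i) (b (orbit \<sigma> x))" if "x \<in> {1..n}" for x
  proof -
    have "x \<in> orbit \<sigma> (a (orbit \<sigma> x))"
      using a[OF orbit_in_cycles[OF that]] self_in_orbit[OF \<sigma>] by metis
    then have "\<exists>i. x = (\<sigma> ^^ i) (a (orbit \<sigma> x))" using orbit_funpow[OF \<sigma>] by blast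
    from someI_ex[OF this] show ?thesis using that unfolding g_def by (simp only: if_True) blast
  qed
  have gI: "g x = (\<tau> ^^ i) (b u)" if "x \<in> {1..n}" "u = orbit \<sigma> x" "x = (\<sigma> ^^ i) (a u)" for x i u
    using pow[OF that(1)] wd[OF orbit_in_cycles[OF that(1)]] that by metis
  have g_in: "g x \<in> h (orbit \<sigma> x)" if "x \<in> {1..n}" for x
    using pow[OF that] b[OF orbit_in_cycles[OF that]] orbit_funpow[OF \<tau>] by metis
  have "inj_on g {1..n}"
  proof (rule inj_onI)
    fix x y assume xy: "x \<in> {1..n}" "y \<in> {1..n}" "g x = g y"
    have "h (orbit \<sigma> x) = h (orbit \<sigma> y)"
      using g_in xy b orbit_in_cycles in_cycles_iff[OF \<tau>] by metis
    then have "orbit \<sigma> x = orbit \<sigma> y"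
      using bij_betw_imp_inj_on[OF h(1)] xy orbit_in_cycles by (metis inj_onD)
    then show "x = y" using pow[OF xy(1)] pow[OF xy(2)] wd[OF orbit_in_cycles[OF xy(1)]] xy(3) by metis
  qed
  moreover have "g \<in> {1..n} \<rightarrow> {1..n}"
    using g_in b orbit_in_cycles in_cycles_iff[OF \<tau>] by blast
  moreover have "g x = x" if "x \<notin> {1..n}" for x using that by (simp only: g_def if_False)
  ultimately have "g permutes {1..n}" by (intro inj_imp_permutes) auto
  then have g: "g \<in> Sym n" by (simp add: Sym_def)
  have "g (\<sigma> x) = \<tau> (g x)" for x
  proof (cases "x \<in> {1..n}")
    case True
    obtain i where i: "x = (\<sigma> ^^ i) (a (orbit \<sigma> x))" "g x = (\<tau> ^^ i) (b (orbit \<sigma> x))"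
      using pow[OF True] by blast
    have "g (\<sigma> x) = (\<tau> ^^ Suc i) (b (orbit \<sigma> x))"
    proof (rule gI)
      show "\<sigma> x \<in> {1..n}" using Sym_in_range[OF \<sigma>] True by blast
      show "orbit \<sigma> x = orbit \<sigma> (\<sigma> x)" by (rule orbit_eq[OF \<sigma> orbit.base, symmetric])
      show "\<sigma> x = (\<sigma> ^^ Suc i) (a (orbit \<sigma> x))" using i(1) by simp
    qed
    then show ?thesis using i(2) by simp
  next
    case False
    then show ?thesis using Sym_out[OF \<sigma>] Sym_out[OF \<tau>] Sym_out[OF g] by metis
  qed
  then show ?thesis using g by (intro bexI[of _ g]) auto
qed

subsection \<open>The Feray-Sniady formula\<close>

lemma permutes_restrict_Sym:
  assumes "\<sigma> \<in> Sym n" "\<And>x. x \<in> {1..n} \<Longrightarrow> x \<notin> A \<Longrightarrow> \<sigma> x = x"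
  shows "\<sigma> permutes A"
  using assms unfolding Sym_def by (auto intro: permutes_superset)

lemma ex_Sym_extending:
  assumes "k \<le> n" "f \<in> {1..k} \<rightarrow>\<^sub>E {1..n}" "inj_on f {1..k}"
  shows "\<exists>g\<in>Sym n. restrict g {1..k} = f"
proof -
  have "card ({1..n} - f ` {1..k}) = n - k"
    using assms by (subst card_Diff_subset) (auto simp: card_image)
  then have "\<exists>h. bij_betw h {k<..n} ({1..n} - f ` {1..k})"
    by (intro finite_same_card_bij) auto
  then obtain h where h: "bij_betw h {k<..n} ({1..n} - f ` {1..k})" by blast
  define g where "g = (\<lambda>x. if x \<in> {1..k} then f x else if x \<in> {k<..n} then h x else x)"
  have gk: "g x = f x" if "x \<in> {1..k}" for x using that by (simp add: g_def)
  have gn: "g x = h x" if "x \<in> {k<..n}" for x using that by (simp add: g_def)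
  have split: "{1..n} = {1..k} \<union> {k<..n}" using assms(1) by auto
  have "bij_betw g {1..k} (f ` {1..k})"
    using bij_betw_imageI[OF assms(3) refl] by (subst bij_betw_cong[OF gk])
  moreover have "bij_betw g {k<..n} ({1..n} - f ` {1..k})"
    using h by (subst bij_betw_cong[OF gn])
  ultimately have "bij_betw g ({1..k} \<union> {k<..n}) (f ` {1..k} \<union> ({1..n} - f ` {1..k}))"
    by (rule bij_betw_combine) auto
  moreover have "f ` {1..k} \<union> ({1..n} - f ` {1..k}) = {1..n}" using assms(2) by auto
  ultimately have "bij_betw g {1..n} {1..n}" using split by simp
  moreover have "g x = x" if "x \<notin> {1..n}" for x
    using that assms(1) unfolding g_def by auto
  ultimately have "g \<in> Sym n" unfolding Sym_def by (auto intro: bij_imp_permutes)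
  moreover have "restrict g {1..k} = f"
    using gk assms(2) by (intro ext) (auto simp: restrict_def PiE_def extensional_def)
  ultimately show ?thesis by blast
qed

text \<open>The extensions form a coset: any two differ by a permutation of the \<open>n - k\<close>
  points above \<open>k\<close>.\<close>

lemma card_Sym_extending:
  assumes "k \<le> n" "f \<in> {1..k} \<rightarrow>\<^sub>E {1..n}" "inj_on f {1..k}"
  shows "card {g \<in> Sym n. restrict g {1..k} = f} = fact (n - k)"
proof -
  obtain g0 where g0: "g0 \<in> Sym n" "restrict g0 {1..k} = f" using ex_Sym_extending[OF assms] by blast
  have eq_iff: "restrict (g0 \<circ> r) {1..k} = f \<longleftrightarrow> (\<forall>x\<in>{1..k}. r x = x)" for r
  proof -
    have "restrict (g0 \<circ> r) {1..k} = f \<longleftrightarrow> (\<forall>x\<in>{1..k}. g0 (r x) = g0 x)"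
      unfolding g0(2)[symmetric] by (auto simp: fun_eq_iff restrict_def)
    then show ?thesis using Sym_inj[OF g0(1)] by (metis injD)
  qed
  have "bij_betw (\<lambda>r. g0 \<circ> r) {r. r permutes {k<..n}} {g \<in> Sym n. restrict g {1..k} = f}"
  proof (rule bij_betwI[where g = "\<lambda>g. inv g0 \<circ> g"])
    show "(\<lambda>r. g0 \<circ> r) \<in> {r. r permutes {k<..n}} \<rightarrow> {g \<in> Sym n. restrict g {1..k} = f}"
    proof (intro funcsetI CollectI conjI)
      fix r assume r: "r \<in> {r. r permutes {k<..n}}"
      then have "r \<in> Sym n" unfolding Sym_def by (auto intro: permutes_subset)
      then show "g0 \<circ> r \<in> Sym n" by (rule Sym_comp[OF g0(1)])
      show "restrict (g0 \<circ> r) {1..k} = f" unfolding eq_iff using r permutes_not_in[of r "{k<..n}"] by simp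
    qed
    show "(\<lambda>g. inv g0 \<circ> g) \<in> {g \<in> Sym n. restrict g {1..k} = f} \<rightarrow> {r. r permutes {k<..n}}"
    proof (intro funcsetI CollectI)
      fix g assume g: "g \<in> {g \<in> Sym n. restrict g {1..k} = f}"
      then have "g0 \<circ> (inv g0 \<circ> g) = g" using g0(1) by simp
      then have "\<forall>x\<in>{1..k}. (inv g0 \<circ> g) x = x" using g eq_iff[of "inv g0 \<circ> g"] by simp
      moreover have "inv g0 \<circ> g \<in> Sym n" using g by (intro Sym_comp Sym_inv g0(1)) simp
      ultimately show "inv g0 \<circ> g permutes {k<..n}"
        by (intro permutes_restrict_Sym[of _ n]) auto
    qed
  qed (use g0(1) in auto)
  then have "card {g \<in> Sym n. restrict g {1..k} = f} = card {r. r permutes {k<..n}}"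
    by (rule bij_betw_same_card[symmetric])
  then show ?thesis using card_permutations[of "{k<..n}" "n - k"] by simp
qed

text \<open>Grouping by the restriction, all fibres have size \<open>fact (n - k)\<close>. This
  factor later completes the falling factorial of the normalized character to
  \<open>fact n\<close>.\<close>

lemma sum_Sym_restrict:
  fixes \<phi> :: "(nat \<Rightarrow> nat) \<Rightarrow> complex"
  assumes "k \<le> n"
  shows "(\<Sum>g\<in>Sym n. \<phi> (restrict g {1..k}))
    = fact (n - k) * (\<Sum>f | f \<in> {1..k} \<rightarrow>\<^sub>E {1..n} \<and> inj_on f {1..k}. \<phi> f)"
proof -
  let ?F = "{f. f \<in> {1..k} \<rightarrow>\<^sub>E {1..n} \<and> inj_on f {1..k}}"
  have fin: "finite ?F"
    by (rule finite_subset[of _ "{1..k} \<rightarrow>\<^sub>E {1..n}"]) (auto intro: finite_PiE)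
  have sub: "(\<lambda>g. restrict g {1..k}) ` Sym n \<subseteq> ?F"
  proof (rule image_subsetI, rule CollectI, rule conjI)
    fix g assume g: "g \<in> Sym n"
    show "inj_on (restrict g {1..k}) {1..k}"
      using Sym_inj[OF g] by (auto simp: inj_on_def restrict_def dest: injD)
    show "restrict g {1..k} \<in> {1..k} \<rightarrow>\<^sub>E {1..n}"
    proof (rule restrict_PiE_iff[THEN iffD2], rule ballI)
      fix x assume "x \<in> {1..k}"
      then have "x \<in> {1..n}" using assms by auto
      then show "g x \<in> {1..n}" using Sym_in_range[OF g] by blast
    qed
  qed
  have "(\<Sum>g\<in>Sym n. \<phi> (restrict g {1..k}))
      = (\<Sum>f\<in>?F. \<Sum>g\<in>{g \<in> Sym n. restrict g {1..k} = f}. \<phi> (restrict g {1..k}))"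
    by (rule sum.group[symmetric, OF finite_Sym fin sub])
  also have "\<dots> = (\<Sum>f\<in>?F. fact (n - k) * \<phi> f)"
  proof (rule sum.cong[OF refl])
    fix f assume "f \<in> ?F"
    then have "card {g \<in> Sym n. restrict g {1..k} = f} = fact (n - k)"
      by (intro card_Sym_extending assms) auto
    then show "(\<Sum>g\<in>{g \<in> Sym n. restrict g {1..k} = f}. \<phi> (restrict g {1..k})) = fact (n - k) * \<phi> f"
      by simp
  qed
  finally show ?thesis by (simp add: sum_distrib_left)
qed

section \<open>Signed factorizations relative to a filling\<close>

lemma stab_conj_iff:
  assumes "g \<in> Sym n" "s \<in> Sym n"
  shows "inv g \<circ> s \<circ> g \<in> stab n f \<longleftrightarrow> s \<in> stab n (f \<circ> inv g)"
proof -
  have "inv g \<circ> s \<circ> g \<in> Sym n" using assms by (intro Sym_comp Sym_inv)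
  moreover have "(\<forall>x\<in>{1..n}. f ((inv g \<circ> s \<circ> g) x) = f x) \<longleftrightarrow> (\<forall>y\<in>{1..n}. f (inv g (s y)) = f (inv g y))"
  proof (intro iffI ballI)
    fix y assume *: "\<forall>x\<in>{1..n}. f ((inv g \<circ> s \<circ> g) x) = f x" and "y \<in> {1..n}"
    then have "inv g y \<in> {1..n}" using Sym_in_range[OF Sym_inv[OF assms(1)]] by blast
    with * have "f ((inv g \<circ> s \<circ> g) (inv g y)) = f (inv g y)" by blast
    then show "f (inv g (s y)) = f (inv g y)" using assms(1) by simp
  next
    fix x assume *: "\<forall>y\<in>{1..n}. f (inv g (s y)) = f (inv g y)" and "x \<in> {1..n}"
    then have "g x \<in> {1..n}" using Sym_in_range[OF assms(1)] by blast
    with * have "f (inv g (s (g x))) = f (inv g (g x))" by blast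
    then show "f ((inv g \<circ> s \<circ> g) x) = f x" using assms(1) by simp
  qed
  ultimately show ?thesis using assms by (simp add: stab_def)
qed

lemma stab_Sym_smaller:
  assumes "k \<le> n" "\<sigma> \<in> Sym k"
  shows "\<sigma> \<in> stab n f \<longleftrightarrow> \<sigma> \<in> stab k f"
proof -
  have "(\<forall>x\<in>{1..n}. f (\<sigma> x) = f x) \<longleftrightarrow> (\<forall>x\<in>{1..k}. f (\<sigma> x) = f x)"
    using assms(1) Sym_out[OF assms(2)] by (metis atLeastAtMost_iff order_trans)
  then show ?thesis using assms Sym_mono by (simp only: stab_def mem_Collect_eq)
qed

lemma stab_cong:
  assumes "\<And>x. x \<in> {1..k} \<Longrightarrow> f x = f' x" shows "stab k f = stab k f'"
proof -
  have "f (\<sigma> x) = f x \<longleftrightarrow> f' (\<sigma> x) = f' x" if "\<sigma> \<in> Sym k" "x \<in> {1..k}" for \<sigma> x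
    using assms that(2) Sym_in_range[OF that(1)] by metis
  then show ?thesis unfolding stab_def by blast
qed

context diagram
begin

text \<open>Counts the factorizations
  \<open>\<beta> = inv \<alpha> \<circ> (\<alpha> \<circ> \<beta>)\<close> into a row-preserving and
  a column-preserving permutation of positions, with the sign of the column part. Only the boxes of
  the entries \<open>f x\<close> with \<open>x\<close> in \<open>{1..k}\<close> enter, so it also
  makes sense for maps \<open>f\<close> that are not injective.\<close>

definition signed_sum :: "nat \<Rightarrow> (nat \<Rightarrow> nat) \<Rightarrow> (nat \<Rightarrow> nat) \<Rightarrow> complex" where
  "signed_sum k \<beta> f = (\<Sum>\<alpha>\<in>Sym k.
     if \<alpha> \<in> stab k (row \<circ> f) \<and> \<alpha> \<circ> \<beta> \<in> stab k (col \<circ> f) then of_int (sign (\<alpha> \<circ> \<beta>)) else 0)"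

text \<open>Conjugation by \<open>g\<close> turns factorizations of
  \<open>inv g \<circ> \<beta> \<circ> g\<close> for the fixed diagram into factorizations of
  \<open>\<beta>\<close> for the filling \<open>inv g\<close>.\<close>

lemma sum_e_conj:
  assumes \<beta>: "\<beta> \<in> Sym n"
  shows "(\<Sum>g\<in>Sym n. e (inv g \<circ> \<beta> \<circ> g)) = (\<Sum>g\<in>Sym n. signed_sum n \<beta> g)"
proof -
  have "(\<Sum>g\<in>Sym n. e (inv g \<circ> \<beta> \<circ> g)) = (\<Sum>g\<in>Sym n. signed_sum n \<beta> (inv g))"
  proof (rule sum.cong[OF refl])
    fix g assume g: "g \<in> Sym n"
    let ?h = "\<lambda>s. if s \<in> P \<and> inv s \<circ> (inv g \<circ> \<beta> \<circ> g) \<in> Q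
      then of_int (sign (inv s \<circ> (inv g \<circ> \<beta> \<circ> g))) else (0::complex)"
    have "e (inv g \<circ> \<beta> \<circ> g) = (\<Sum>s\<in>Sym n. ?h s)" by (rule e_expand)
    also have "\<dots> = (\<Sum>s\<in>Sym n. ?h (inv g \<circ> (s \<circ> g)))"
      by (rule sum.reindex_bij_witness[where i = "\<lambda>s. inv g \<circ> (s \<circ> g)" and j = "\<lambda>s. g \<circ> (s \<circ> inv g)"])
         (use g in \<open>auto simp: comp_assoc intro!: Sym_comp Sym_inv\<close>)
    \<comment> \<open>Inverting the row part makes the column part \<open>s \<circ> \<beta>\<close>,
      the form used in \<open>signed_sum\<close>.\<close>
    also have "\<dots> = (\<Sum>s\<in>Sym n. ?h (inv g \<circ> (inv s \<circ> g)))"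
      by (rule Sym_sum_inv[symmetric])
    also have "\<dots> = signed_sum n \<beta> (inv g)"
      unfolding signed_sum_def
    proof (rule sum.cong[OF refl])
      fix s assume s: "s \<in> Sym n"
      have 1: "inv g \<circ> (inv s \<circ> g) \<in> P \<longleftrightarrow> s \<in> stab n (row \<circ> inv g)"
        using stab_conj_iff[OF g Sym_inv[OF s], of row] stab_inv[of s n "row \<circ> inv g"]
          stab_inv[of "inv s" n "row \<circ> inv g"] s by (auto simp: comp_assoc)
      have i: "inv (inv g \<circ> (inv s \<circ> g)) = inv g \<circ> s \<circ> g"
        using g s Sym_inv_comp[OF Sym_inv[OF g] Sym_comp[OF Sym_inv[OF s] g]]
          Sym_inv_comp[OF Sym_inv[OF s] g] by simp
      have 2: "inv (inv g \<circ> (inv s \<circ> g)) \<circ> (inv g \<circ> \<beta> \<circ> g) = inv g \<circ> (s \<circ> \<beta>) \<circ> g"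
        unfolding i using g by (simp add: comp_assoc)
      have 3: "sign (inv g \<circ> (s \<circ> \<beta>) \<circ> g) = sign (s \<circ> \<beta>)"
        using g s \<beta> by (simp add: sign_comp Sym_comp Sym_inv sign_inverse Sym_permutation)
      show "?h (inv g \<circ> (inv s \<circ> g)) = (if s \<in> stab n (row \<circ> inv g) \<and> s \<circ> \<beta> \<in> stab n (col \<circ> inv g)
          then of_int (sign (s \<circ> \<beta>)) else 0)"
        unfolding 1 2 3 stab_conj_iff[OF g Sym_comp[OF s \<beta>]] ..
    qed
    finally show "e (inv g \<circ> \<beta> \<circ> g) = signed_sum n \<beta> (inv g)" .
  qed
  also have "\<dots> = (\<Sum>g\<in>Sym n. signed_sum n \<beta> g)" by (rule Sym_sum_inv)
  finally show ?thesis .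
qed

text \<open>If \<open>\<alpha>\<close> preserves rows, \<open>\<alpha>\<beta>\<close> preserves columns and \<open>\<beta>\<close> fixes \<open>x\<close>, then \<open>x\<close> and \<open>\<alpha> x\<close> share
  their row and their column.\<close>

lemma signed_sum_smaller:
  assumes k: "k \<le> n" and \<beta>: "\<beta> \<in> Sym k" and g: "g \<in> Sym n"
  shows "signed_sum n \<beta> g = signed_sum k \<beta> (restrict g {1..k})"
proof -
  let ?C = "\<lambda>j \<alpha>. \<alpha> \<in> stab j (row \<circ> g) \<and> \<alpha> \<circ> \<beta> \<in> stab j (col \<circ> g)"
  have gr: "g x \<in> {1..n}" if "x \<in> {1..n}" for x using that Sym_in_range[OF g] by blast
  have small: "\<alpha> \<in> Sym k" if \<alpha>: "\<alpha> \<in> Sym n" and C: "?C n \<alpha>" for \<alpha>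
  proof -
    have "\<alpha> x = x" if x: "x \<in> {1..n}" "x \<notin> {1..k}" for x
    proof -
      have \<alpha>x: "\<alpha> x \<in> {1..n}" using Sym_in_range[OF \<alpha>] x by blast
      have "row (g (\<alpha> x)) = row (g x)"
        using stab_apply[of \<alpha> n "row \<circ> g" x] C x(1) by simp
      moreover have "col (g (\<alpha> x)) = col (g x)"
        using stab_apply[of "\<alpha> \<circ> \<beta>" n "col \<circ> g" x] C x(1) Sym_out[OF \<beta> x(2)] by simp
      ultimately have "g (\<alpha> x) = g x" by (rule box_eq[OF gr[OF \<alpha>x] gr[OF x(1)]])
      then show ?thesis using Sym_inj[OF g] by (auto dest: injD)
    qed
    then have "\<alpha> permutes {1..k}" by (intro permutes_restrict_Sym[OF \<alpha>])
    then show ?thesis by (simp only: Sym_def mem_Collect_eq)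
  qed
  have C_iff: "?C n \<alpha> \<longleftrightarrow> ?C k \<alpha>" if "\<alpha> \<in> Sym k" for \<alpha>
    using stab_Sym_smaller[OF k that] stab_Sym_smaller[OF k Sym_comp[OF that \<beta>]] by blast
  have cong: "stab k (f \<circ> restrict g {1..k}) = stab k (f \<circ> g)" for f :: "nat \<Rightarrow> nat"
    by (rule stab_cong) simp
  have "signed_sum n \<beta> g = (\<Sum>\<alpha>\<in>Sym k. if ?C n \<alpha> then of_int (sign (\<alpha> \<circ> \<beta>)) else 0)"
    unfolding signed_sum_def
    by (rule sum.mono_neutral_right) (use small Sym_mono[OF k] in auto)
  also have "\<dots> = signed_sum k \<beta> (restrict g {1..k})"
    unfolding signed_sum_def cong by (intro sum.cong refl) (simp only: C_iff)
  finally show ?thesis .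
qed

text \<open>The transposition \<open>t = (x y)\<close> preserves the rows and the columns of \<open>f\<close>, so \<open>\<alpha> \<mapsto> t\<alpha>\<close> is a
  sign-reversing bijection.\<close>

lemma signed_sum_not_inj:
  assumes \<beta>: "\<beta> \<in> Sym k" and xy: "x \<in> {1..k}" "y \<in> {1..k}" "x \<noteq> y" "f x = f y"
  shows "signed_sum k \<beta> f = 0"
proof -
  let ?t = "transpose x y"
  let ?h = "\<lambda>\<alpha>. if \<alpha> \<in> stab k (row \<circ> f) \<and> \<alpha> \<circ> \<beta> \<in> stab k (col \<circ> f)
      then of_int (sign (\<alpha> \<circ> \<beta>)) else (0::complex)"
  have t: "?t \<in> stab k (row \<circ> f)" "?t \<in> stab k (col \<circ> f)"
    using xy by (auto intro!: transpose_stab)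
  have "signed_sum k \<beta> f = (\<Sum>\<alpha>\<in>Sym k. ?h (?t \<circ> \<alpha>))"
    unfolding signed_sum_def by (rule Sym_sum_comp_left[symmetric]) (rule stab_Sym[OF t(1)])
  also have "\<dots> = (\<Sum>\<alpha>\<in>Sym k. - ?h \<alpha>)"
  proof (rule sum.cong[OF refl])
    fix \<alpha> assume \<alpha>: "\<alpha> \<in> Sym k"
    have "sign (?t \<circ> (\<alpha> \<circ> \<beta>)) = - sign (\<alpha> \<circ> \<beta>)"
      using xy(3) Sym_permutation[OF Sym_comp[OF \<alpha> \<beta>]] Sym_permutation[OF stab_Sym[OF t(1)]]
      by (simp add: sign_compose sign_swap_id)
    then show "?h (?t \<circ> \<alpha>) = - ?h \<alpha>"
      by (simp add: comp_assoc stab_left_iff[OF t(1)] stab_left_iff[OF t(2)])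
  qed
  also have "\<dots> = - signed_sum k \<beta> f" by (simp add: signed_sum_def sum_negf)
  finally show ?thesis by simp
qed

lemma sum_e_conj_eq_sum_functions:
  assumes k: "k \<le> n" and \<beta>: "\<beta> \<in> Sym k"
  shows "(\<Sum>g\<in>Sym n. e (inv g \<circ> \<beta> \<circ> g))
    = fact (n - k) * (\<Sum>f\<in>{1..k} \<rightarrow>\<^sub>E {1..n}. signed_sum k \<beta> f)"
proof -
  have "(\<Sum>g\<in>Sym n. e (inv g \<circ> \<beta> \<circ> g)) = (\<Sum>g\<in>Sym n. signed_sum k \<beta> (restrict g {1..k}))"
    using signed_sum_smaller[OF k \<beta>] by (subst sum_e_conj[OF Sym_mono[OF k \<beta>]]) (auto intro: sum.cong)
  also have "\<dots> = fact (n - k) * (\<Sum>f | f \<in> {1..k} \<rightarrow>\<^sub>E {1..n} \<and> inj_on f {1..k}. signed_sum k \<beta> f)"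
    by (rule sum_Sym_restrict[OF k])
  also have "(\<Sum>f | f \<in> {1..k} \<rightarrow>\<^sub>E {1..n} \<and> inj_on f {1..k}. signed_sum k \<beta> f)
      = (\<Sum>f\<in>{1..k} \<rightarrow>\<^sub>E {1..n}. signed_sum k \<beta> f)"
  proof (rule sum.mono_neutral_left)
    show "\<forall>f\<in>({1..k} \<rightarrow>\<^sub>E {1..n}) - {f. f \<in> {1..k} \<rightarrow>\<^sub>E {1..n} \<and> inj_on f {1..k}}. signed_sum k \<beta> f = 0"
    proof
      fix f assume "f \<in> ({1..k} \<rightarrow>\<^sub>E {1..n}) - {f. f \<in> {1..k} \<rightarrow>\<^sub>E {1..n} \<and> inj_on f {1..k}}"
      then have "\<not> inj_on f {1..k}" by blast
      then obtain x y where "x \<in> {1..k}" "y \<in> {1..k}" "f x = f y" "x \<noteq> y"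
        unfolding inj_on_def by blast
      then show "signed_sum k \<beta> f = 0" by (intro signed_sum_not_inj[OF \<beta>])
    qed
  qed (auto intro: finite_PiE)
  finally show ?thesis .
qed

end

section \<open>Normalized characters as signed sums\<close>

lemma card_Sym: "card (Sym n) = fact n"
  unfolding Sym_def by (rule card_permutations) auto

text \<open>\<open>irr_char\<close> evaluates at an arbitrary representative. The formula for
  \<open>irr_char_perm\<close> averages over conjugates, so replacing \<open>g\<close> by
  \<open>h \<circ> g\<close> shows that it takes the same value at conjugate permutations.\<close>

lemma irr_char_cycle_type:
  fixes \<omega> :: "nat multiset"
  defines "n \<equiv> \<Sum>\<^sub># \<omega>"
  assumes \<pi>: "\<pi> \<in> Sym n"
  shows "irr_char \<omega> (cycle_type n \<pi>) = irr_char_perm \<omega> \<pi>"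
proof -
  let ?y = "young_symmetrizer \<omega>"
  define \<sigma> where "\<sigma> = (SOME \<sigma>. \<sigma> \<in> Sym n \<and> cycle_type n \<sigma> = cycle_type n \<pi>)"
  have \<sigma>: "\<sigma> \<in> Sym n \<and> cycle_type n \<sigma> = cycle_type n \<pi>"
    unfolding \<sigma>_def by (rule someI[of _ \<pi>]) (simp add: \<pi>)
  then obtain h where h: "h \<in> Sym n" "h \<circ> \<sigma> = \<pi> \<circ> h"
    using conjugate_if_same_cycle_type[of \<sigma> n \<pi>] \<pi> by blast
  have "inv h \<circ> inv \<pi> = inv (\<pi> \<circ> h)" by (rule Sym_inv_comp[OF \<pi> h(1), symmetric])
  also have "\<dots> = inv \<sigma> \<circ> inv h" using Sym_inv_comp[OF h(1)] \<sigma> h(2) by metis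
  finally have conj: "inv h \<circ> (inv \<pi> \<circ> h) = inv \<sigma>"
    using h(1) by (metis Sym_inv_o(6) comp_assoc)
  obtain c where c: "\<And>\<pi>. \<pi> \<in> Sym n \<Longrightarrow> irr_char_perm \<omega> \<pi>
      = (\<Sum>g\<in>Sym n. ?y (inv g \<circ> inv \<pi> \<circ> g)) / c"
    using irr_char_perm_formula[of \<omega>] unfolding n_def by blast
  have "(\<Sum>g\<in>Sym n. ?y (inv g \<circ> inv \<sigma> \<circ> g)) = (\<Sum>g\<in>Sym n. ?y (inv (h \<circ> g) \<circ> inv \<pi> \<circ> (h \<circ> g)))"
    using h(1) by (intro sum.cong refl) (simp add: Sym_inv_comp comp_assoc flip: conj)
  also have "\<dots> = (\<Sum>g\<in>Sym n. ?y (inv g \<circ> inv \<pi> \<circ> g))"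
    by (rule Sym_sum_comp_left[OF h(1)])
  finally have "irr_char_perm \<omega> \<sigma> = irr_char_perm \<omega> \<pi>" using c \<pi> \<sigma> by simp
  then show ?thesis by (simp add: irr_char_def \<sigma>_def n_def)
qed

lemma falling_fact: "k \<le> n \<Longrightarrow> (\<Prod>i<k. of_nat n - of_nat i) * fact (n - k) = (fact n :: complex)"
proof (induction k)
  case (Suc k)
  have "fact (n - k) = (of_nat n - of_nat k) * (fact (n - Suc k) :: complex)"
    using Suc.prems by (subst fact_reduce) (auto simp: of_nat_diff)
  then show ?case using Suc by (simp add: mult.assoc)
qed simp

lemma normalized_char_eq_signed_sum:
  fixes \<omega> \<mu> :: "nat multiset"
  defines "n \<equiv> \<Sum>\<^sub># \<omega>"
  assumes k: "k \<le> n" and \<beta>: "\<beta> \<in> Sym k" and \<mu>: "cycle_type k \<beta> = \<mu>" "\<Sum>\<^sub># \<mu> = k"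
  shows "normalized_char \<omega> \<mu> = (\<Sum>f\<in>{1..k} \<rightarrow>\<^sub>E {1..n}.
    diagram.signed_sum (\<lambda>x. fst (box_of \<omega> x)) (\<lambda>x. snd (box_of \<omega> x)) k \<beta> f)"
proof -
  define r where "r = rev (sorted_list_of_multiset \<omega>)"
  interpret diagram n "length r" "\<lambda>i. r ! i" "\<lambda>x. fst (box_of \<omega> x)" "\<lambda>x. snd (box_of \<omega> x)"
    unfolding n_def r_def by (rule diagram_boxes)
  have y: "young_symmetrizer \<omega> = e"
    unfolding e_def young_symmetrizer_def row_group_def col_group_def stab_def
    unfolding n_def by (rule refl)
  obtain c where c: "c \<noteq> 0" "\<And>\<pi>. \<pi> \<in> Sym n \<Longrightarrow> irr_char_perm \<omega> \<pi>
      = (\<Sum>g\<in>Sym n. e (inv g \<circ> inv \<pi> \<circ> g)) / c"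
    using irr_char_perm_formula[of \<omega>] unfolding y n_def by blast
  have \<beta>n: "\<beta> \<in> Sym n" by (rule Sym_mono[OF k \<beta>])
  \<comment> \<open>The trace formula involves the inverse of its argument, so
    \<open>inv \<beta>\<close>, of the same type, is taken as representative and
    \<open>\<beta>\<close> itself appears in the sum.\<close>
  have "\<mu> + replicate_mset (n - k) 1 = cycle_type n (inv \<beta>)"
    using cycle_type_inv[OF \<beta>n] cycle_type_extend[OF k \<beta>] \<mu>(1) by simp
  then have "irr_char \<omega> (\<mu> + replicate_mset (n - k) 1) = irr_char_perm \<omega> (inv \<beta>)"
    using irr_char_cycle_type[of "inv \<beta>" \<omega>] Sym_inv[OF \<beta>n] by (simp add: n_def)
  also have "\<dots> = (\<Sum>g\<in>Sym n. e (inv g \<circ> \<beta> \<circ> g)) / c"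
    using c(2)[OF Sym_inv[OF \<beta>n]] Sym_inv_o(3)[OF \<beta>n] by simp
  also have "\<dots> = fact (n - k) * (\<Sum>f\<in>{1..k} \<rightarrow>\<^sub>E {1..n}. signed_sum k \<beta> f) / c"
    by (simp only: sum_e_conj_eq_sum_functions[OF k \<beta>])
  finally have num: "irr_char \<omega> (\<mu> + replicate_mset (n - k) 1)
      = fact (n - k) * (\<Sum>f\<in>{1..k} \<rightarrow>\<^sub>E {1..n}. signed_sum k \<beta> f) / c" .
  have "irr_char \<omega> (replicate_mset n 1) = irr_char_perm \<omega> id"
    using irr_char_cycle_type[of id \<omega>] by (simp add: n_def cycle_type_id)
  also have "\<dots> = (\<Sum>g\<in>Sym n. e id) / c"
    by (simp add: c(2) cong: sum.cong)
  finally have den: "irr_char \<omega> (replicate_mset n 1) = fact n / c"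
    by (simp add: e_id card_Sym)
  have "normalized_char \<omega> \<mu>
      = ((\<Prod>i<k. of_nat n - of_nat i) * fact (n - k)) * (\<Sum>f\<in>{1..k} \<rightarrow>\<^sub>E {1..n}. signed_sum k \<beta> f) / fact n"
    unfolding normalized_char_def Let_def \<mu>(2) n_def[symmetric] num den using c(1) by simp
  also have "\<dots> = (\<Sum>f\<in>{1..k} \<rightarrow>\<^sub>E {1..n}. signed_sum k \<beta> f)"
    unfolding falling_fact[OF k] by simp
  finally show ?thesis .
qed

subsection \<open>Counting fillings of the cycles\<close>

context diagram
begin

text \<open>A compatible \<open>f\<close> amounts to a row for each cycle of \<open>\<alpha>\<close>
  and a column for each cycle of \<open>\<gamma>\<close> such that the box prescribed at every point
  exists. Once the rows \<open>\<rho>\<close> are fixed, the columns are independent;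
  \<open>bd \<rho> u\<close> is the length of the shortest row met by \<open>u\<close>, left
  abstract so that it can be supplied through colours.\<close>

lemma card_compatible_functions:
  assumes \<alpha>: "\<alpha> \<in> Sym k" and \<gamma>: "\<gamma> \<in> Sym k"
    and bd: "\<And>\<rho> u j. \<rho> \<in> cycles k \<alpha> \<rightarrow>\<^sub>E {..<L} \<Longrightarrow> u \<in> cycles k \<gamma> \<Longrightarrow>
      j < bd \<rho> u \<longleftrightarrow> (\<forall>x\<in>u. j < len (\<rho> (orbit \<alpha> x)))"
  shows "card {f \<in> {1..k} \<rightarrow>\<^sub>E {1..n}. \<alpha> \<in> stab k (row \<circ> f) \<and> \<gamma> \<in> stab k (col \<circ> f)}
    = (\<Sum>\<rho>\<in>cycles k \<alpha> \<rightarrow>\<^sub>E {..<L}. \<Prod>u\<in>cycles k \<gamma>. bd \<rho> u)"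
proof -
  let ?F = "{f \<in> {1..k} \<rightarrow>\<^sub>E {1..n}. \<alpha> \<in> stab k (row \<circ> f) \<and> \<gamma> \<in> stab k (col \<circ> f)}"
  let ?R = "cycles k \<alpha> \<rightarrow>\<^sub>E {..<L}"
  define S where "S = (SIGMA \<rho>:?R. \<Pi>\<^sub>E u\<in>cycles k \<gamma>. {..<bd \<rho> u})"
  \<comment> \<open>The representative chosen by \<open>SOME\<close> is harmless: for compatible
    \<open>f\<close> rows are constant along cycles of \<open>\<alpha>\<close> and columns along
    cycles of \<open>\<gamma>\<close>.\<close>
  define \<Psi> where "\<Psi> f = (\<lambda>w\<in>cycles k \<alpha>. row (f (SOME x. x \<in> w)), \<lambda>u\<in>cycles k \<gamma>. col (f (SOME x. x \<in> u)))"
    for f :: "nat \<Rightarrow> nat"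
  have const: "h (SOME y. y \<in> orbit \<sigma> x) = h x"
    if "\<sigma> \<in> stab k h" "x \<in> {1..k}" for \<sigma> x and h :: "nat \<Rightarrow> nat"
  proof -
    have "(SOME y. y \<in> orbit \<sigma> x) \<in> orbit \<sigma> x"
      using self_in_orbit[OF stab_Sym[OF that(1)], of x] by (rule someI)
    then show ?thesis
      using orbit_invariant[of "{1..k}" h \<sigma> x] stab_apply[OF that(1)] that(2)
        Sym_in_range[OF stab_Sym[OF that(1)]] by blast
  qed
  have \<Psi>1: "fst (\<Psi> f) (orbit \<alpha> x) = row (f x)" and \<Psi>2: "snd (\<Psi> f) (orbit \<gamma> x) = col (f x)"
    if "f \<in> ?F" "x \<in> {1..k}" for f x
    using const[of \<alpha> "row \<circ> f" x] const[of \<gamma> "col \<circ> f" x] that orbit_in_cycles[OF that(2)]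
    by (simp_all add: \<Psi>_def)
  have "bij_betw \<Psi> ?F S"
    unfolding bij_betw_def
  proof
    show "inj_on \<Psi> ?F"
    proof (rule inj_onI)
      fix f g assume f: "f \<in> ?F" and g: "g \<in> ?F" and eq: "\<Psi> f = \<Psi> g"
      have "f x = g x" if x: "x \<in> {1..k}" for x
      proof (rule box_eq)
        show "f x \<in> {1..n}" "g x \<in> {1..n}" using f g x by blast+
        show "row (f x) = row (g x)" using \<Psi>1[OF f x] \<Psi>1[OF g x] eq by simp
        show "col (f x) = col (g x)" using \<Psi>2[OF f x] \<Psi>2[OF g x] eq by simp
      qed
      then show "f = g" using f g by (intro PiE_ext[of f "{1..k}" "\<lambda>_. {1..n}" g]) auto
    qed
    show "\<Psi> ` ?F = S"
    proof (intro equalityI subsetI)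
      fix s assume "s \<in> \<Psi> ` ?F"
      then obtain f where f: "f \<in> ?F" "s = \<Psi> f" by blast
      have fn: "f x \<in> {1..n}" if "x \<in> {1..k}" for x using f that by blast
      have "fst (\<Psi> f) w < L" if w: "w \<in> cycles k \<alpha>" for w
      proof -
        obtain x where "x \<in> {1..k}" "w = orbit \<alpha> x" using w unfolding cycles_def by blast
        then show ?thesis using \<Psi>1[OF f(1)] row_col_less[OF fn] by metis
      qed
      moreover have "fst (\<Psi> f) \<in> extensional (cycles k \<alpha>)" by (simp add: \<Psi>_def)
      ultimately have R: "fst (\<Psi> f) \<in> ?R" by (simp add: PiE_iff)
      have "snd (\<Psi> f) u < bd (fst (\<Psi> f)) u" if u: "u \<in> cycles k \<gamma>" for u
        unfolding bd[OF R u]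
      proof
        fix x assume "x \<in> u"
        then have x: "x \<in> {1..k}" "u = orbit \<gamma> x" using in_cycles_iff[OF \<gamma> u] by blast+
        then show "snd (\<Psi> f) u < len (fst (\<Psi> f) (orbit \<alpha> x))"
          using \<Psi>1[OF f(1) x(1)] \<Psi>2[OF f(1) x(1)] row_col_less[OF fn[OF x(1)]] by simp
      qed
      moreover have "snd (\<Psi> f) \<in> extensional (cycles k \<gamma>)" by (simp add: \<Psi>_def)
      ultimately have "snd (\<Psi> f) \<in> (\<Pi>\<^sub>E u\<in>cycles k \<gamma>. {..<bd (fst (\<Psi> f)) u})"
        by (simp add: PiE_iff)
      with R have "(fst (\<Psi> f), snd (\<Psi> f)) \<in> S" unfolding S_def by - (rule SigmaI)
      then show "s \<in> S" unfolding f(2) by simp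
    next
      fix s assume "s \<in> S"
      then obtain \<rho> c where s: "s = (\<rho>, c)" and \<rho>: "\<rho> \<in> ?R"
        and c: "c \<in> (\<Pi>\<^sub>E u\<in>cycles k \<gamma>. {..<bd \<rho> u})" unfolding S_def by blast
      \<comment> \<open>Since \<open>x\<close> lies in its own \<open>\<gamma>\<close>-cycle, the
        bound on that cycle's column covers the row prescribed at \<open>x\<close>.\<close>
      have "\<exists>y\<in>{1..n}. row y = \<rho> (orbit \<alpha> x) \<and> col y = c (orbit \<gamma> x)" if x: "x \<in> {1..k}" for x
      proof (rule ex_box)
        show "\<rho> (orbit \<alpha> x) < L" using \<rho> orbit_in_cycles[OF x] by blast
        have "c (orbit \<gamma> x) < bd \<rho> (orbit \<gamma> x)" using c orbit_in_cycles[OF x] by blast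
        then show "c (orbit \<gamma> x) < len (\<rho> (orbit \<alpha> x))"
          using bd[OF \<rho> orbit_in_cycles[OF x]] self_in_orbit[OF \<gamma>] by blast
      qed
      then obtain f0 where f0: "\<And>x. x \<in> {1..k} \<Longrightarrow>
          f0 x \<in> {1..n} \<and> row (f0 x) = \<rho> (orbit \<alpha> x) \<and> col (f0 x) = c (orbit \<gamma> x)" by metis
      define f where "f = restrict f0 {1..k}"
      have f: "f x \<in> {1..n}" "row (f x) = \<rho> (orbit \<alpha> x)" "col (f x) = c (orbit \<gamma> x)"
        if "x \<in> {1..k}" for x
        using f0[OF that] that unfolding f_def restrict_def by (simp_all only: if_True)
      have step: "orbit \<sigma> (\<sigma> x) = orbit \<sigma> x" if "\<sigma> \<in> Sym k" for \<sigma> x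
        by (rule orbit_eq[OF that orbit.base])
      have rng: "\<sigma> x \<in> {1..k}" if "\<sigma> \<in> Sym k" "x \<in> {1..k}" for \<sigma> x
        using Sym_in_range[OF that(1)] that(2) by blast
      have "row (f (\<alpha> x)) = row (f x)" if x: "x \<in> {1..k}" for x
        by (simp only: f(2)[OF x] f(2)[OF rng[OF \<alpha> x]] step[OF \<alpha>])
      then have "\<alpha> \<in> stab k (row \<circ> f)" using \<alpha> by (simp add: stab_def)
      moreover have "col (f (\<gamma> x)) = col (f x)" if x: "x \<in> {1..k}" for x
        by (simp only: f(3)[OF x] f(3)[OF rng[OF \<gamma> x]] step[OF \<gamma>])
      then have "\<gamma> \<in> stab k (col \<circ> f)" using \<gamma> by (simp add: stab_def)
      moreover have "f \<in> {1..k} \<rightarrow>\<^sub>E {1..n}" unfolding f_def restrict_PiE_iff by (rule ballI) (rule conjunct1[OF f0])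
      ultimately have fF: "f \<in> ?F" by blast
      have "fst (\<Psi> f) = \<rho>"
      proof (rule extensionalityI)
        show "fst (\<Psi> f) \<in> extensional (cycles k \<alpha>)" by (simp add: \<Psi>_def)
        show "\<rho> \<in> extensional (cycles k \<alpha>)" using \<rho> by (simp add: PiE_iff)
        fix w assume "w \<in> cycles k \<alpha>"
        then obtain x where "x \<in> {1..k}" "w = orbit \<alpha> x" unfolding cycles_def by blast
        then show "fst (\<Psi> f) w = \<rho> w" using \<Psi>1[OF fF] f(2) by metis
      qed
      moreover have "snd (\<Psi> f) = c"
      proof (rule extensionalityI)
        show "snd (\<Psi> f) \<in> extensional (cycles k \<gamma>)" by (simp add: \<Psi>_def)
        show "c \<in> extensional (cycles k \<gamma>)" using c by (simp add: PiE_iff)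
        fix u assume "u \<in> cycles k \<gamma>"
        then obtain x where "x \<in> {1..k}" "u = orbit \<gamma> x" unfolding cycles_def by blast
        then show "snd (\<Psi> f) u = c u" using \<Psi>2[OF fF] f(3) by metis
      qed
      ultimately have "s = \<Psi> f" unfolding s by (simp add: prod_eq_iff)
      then show "s \<in> \<Psi> ` ?F" using fF by blast
    qed
  qed
  then have "card ?F = card S" by (rule bij_betw_same_card)
  also have "\<dots> = (\<Sum>\<rho>\<in>?R. \<Prod>u\<in>cycles k \<gamma>. bd \<rho> u)"
    unfolding S_def by (subst card_SigmaI) (auto intro!: finite_PiE simp: card_PiE)
  finally show ?thesis .
qed

lemma sum_signed_sum:
  "(\<Sum>f\<in>{1..k} \<rightarrow>\<^sub>E {1..n}. signed_sum k \<beta> f) = (\<Sum>\<alpha>\<in>Sym k. of_int (sign (\<alpha> \<circ> \<beta>)) *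
     of_nat (card {f \<in> {1..k} \<rightarrow>\<^sub>E {1..n}. \<alpha> \<in> stab k (row \<circ> f) \<and> \<alpha> \<circ> \<beta> \<in> stab k (col \<circ> f)}))"
proof -
  have fin: "finite ({1..k} \<rightarrow>\<^sub>E {1..n})" by (auto intro: finite_PiE)
  have "(\<Sum>f\<in>{1..k} \<rightarrow>\<^sub>E {1..n}. signed_sum k \<beta> f) = (\<Sum>\<alpha>\<in>Sym k. \<Sum>f\<in>{1..k} \<rightarrow>\<^sub>E {1..n}.
      if \<alpha> \<in> stab k (row \<circ> f) \<and> \<alpha> \<circ> \<beta> \<in> stab k (col \<circ> f) then of_int (sign (\<alpha> \<circ> \<beta>)) else 0)"
    unfolding signed_sum_def by (rule sum.swap)
  then show ?thesis
    by (simp only: sum.If_cases[OF fin] sum_constant mult_zero_left mult_zero_right sum.neutral_const add_0_right Collect_conj_eq[symmetric] Int_def mem_Collect_eq mult.commute)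
qed

end

subsection \<open>Shapes with rectangular blocks\<close>

text \<open>Entry \<open>i\<close> is the colour, that is the block number, of row \<open>i\<close>.
  Storing colours instead of lengths keeps blocks apart that have equal values of
  \<open>q\<close>.\<close>

definition block_rows :: "nat \<Rightarrow> (nat \<Rightarrow> nat) \<Rightarrow> nat list" where
  "block_rows m p = concat (map (\<lambda>i. replicate (p i) i) [1..<Suc m])"

lemma block_rows_Suc: "block_rows (Suc m) p = block_rows m p @ replicate (p (Suc m)) (Suc m)"
  by (simp add: block_rows_def)

lemma block_rows_0: "block_rows 0 p = []"
  by (simp add: block_rows_def)

lemma set_block_rows: "set (block_rows m p) \<subseteq> {1..m}"
  by (auto simp: block_rows_def)

lemma mset_block_rows: "mset (map q (block_rows m p)) = shape m p q"
  by (induction m) (auto simp: block_rows_0 block_rows_Suc shape_def)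

lemma card_block_rows:
  assumes "j \<in> {1..m}"
  shows "card {i \<in> {..<length (block_rows m p)}. block_rows m p ! i = j} = p j"
proof -
  have "length (filter (\<lambda>i. i = j) (block_rows m p)) = (if j \<in> {1..m} then p j else 0)"
    by (induction m) (auto simp: block_rows_0 block_rows_Suc filter_replicate)
  then show ?thesis using assms by (simp add: length_filter_conv_card)
qed

text \<open>For weakly decreasing \<open>q\<close> the order of the blocks is the order by length
  used in \<open>boxes\<close>, so row \<open>i\<close> of the diagram has colour
  \<open>block_rows m p ! i\<close>.\<close>

lemma sorted_block_rows:
  assumes "\<And>i j. i \<in> {1..m} \<Longrightarrow> j \<in> {1..m} \<Longrightarrow> i \<le> j \<Longrightarrow> q j \<le> q i"
  shows "rev (sorted_list_of_multiset (shape m p q)) = map q (block_rows m p)"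
proof -
  have repl: "sorted_wrt (\<ge>) (replicate l x)" for l and x :: nat
    by (induction l) auto
  have "sorted_wrt (\<ge>) (map q (block_rows m p))"
    using assms
  proof (induction m)
    case (Suc m)
    have "q (Suc m) \<le> q i" if "i \<in> set (block_rows m p)" for i
      using set_block_rows[of m p] that by (intro Suc.prems) auto
    then show ?case using Suc
      by (auto simp: block_rows_Suc sorted_wrt_append sorted_wrt_map map_replicate repl)
  qed (simp add: block_rows_0)
  then have "sorted (rev (map q (block_rows m p)))" by (simp add: sorted_wrt_rev)
  then have "sorted_list_of_multiset (mset (rev (map q (block_rows m p)))) = rev (map q (block_rows m p))"
    by (simp only: sorted_list_of_multiset_mset sorted_sort_id)
  then show ?thesis by (simp add: mset_block_rows[symmetric])
qed

text \<open>Among the colours met, the largest has the smallest \<open>q\<close>; this matches the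
  row-length bound with \<open>coloured_mult\<close>.\<close>

lemma less_antitone_Max_iff:
  fixes q :: "nat \<Rightarrow> nat"
  assumes "finite S" "S \<noteq> {}" "S \<subseteq> A"
    and "\<And>i j. i \<in> A \<Longrightarrow> j \<in> A \<Longrightarrow> i \<le> j \<Longrightarrow> q j \<le> q i"
  shows "c < q (Max S) \<longleftrightarrow> (\<forall>s\<in>S. c < q s)"
proof -
  have "q (Max S) \<le> q s" if "s \<in> S" for s
    using that assms Max_in[OF assms(1,2)] Max_ge[OF assms(1)] by blast
  then show ?thesis using Max_in[OF assms(1,2)] by (meson order_less_le_trans)
qed

lemma cycles_meeting:
  assumes \<alpha>: "\<alpha> \<in> Sym k" and u: "u \<subseteq> {1..k}"
  shows "{w \<in> cycles k \<alpha>. w \<inter> u \<noteq> {}} = orbit \<alpha> ` u"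
proof
  show "{w \<in> cycles k \<alpha>. w \<inter> u \<noteq> {}} \<subseteq> orbit \<alpha> ` u"
    using in_cycles_iff[OF \<alpha>] by blast
  show "orbit \<alpha> ` u \<subseteq> {w \<in> cycles k \<alpha>. w \<inter> u \<noteq> {}}"
    using orbit_in_cycles self_in_orbit[OF \<alpha>] u by blast
qed

text \<open>A choice of rows for the cycles of \<open>\<alpha>\<close> is a colouring by blocks
  followed by a choice within each block: the latter gives the product of the \<open>p\<close>, and
  the columns give the product of the \<open>q\<close>.\<close>

lemma normalized_char_shape:
  assumes q: "\<And>i j. i \<in> {1..m} \<Longrightarrow> j \<in> {1..m} \<Longrightarrow> i \<le> j \<Longrightarrow> q j \<le> q i"
    and \<beta>: "\<beta> \<in> Sym k" and \<mu>: "cycle_type k \<beta> = \<mu>" "\<Sum>\<^sub># \<mu> = k"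
    and k: "k \<le> \<Sum>\<^sub># (shape m p q)"
  shows "normalized_char (shape m p q) \<mu> = (\<Sum>a\<in>coloured_perms k m. of_int (sign (fst a \<circ> \<beta>)) *
     of_nat ((\<Prod>w\<in>cycles k (fst a). p (snd a w)) *
             (\<Prod>u\<in>cycles k (fst a \<circ> \<beta>). q (snd (coloured_mult k a \<beta>) u))))"
proof -
  let ?\<omega> = "shape m p q"
  let ?n = "\<Sum>\<^sub># ?\<omega>"
  let ?bl = "block_rows m p"
  let ?L = "length ?bl"
  define row where "row = (\<lambda>x. fst (box_of ?\<omega> x))"
  define col where "col = (\<lambda>x. snd (box_of ?\<omega> x))"
  have srt: "rev (sorted_list_of_multiset ?\<omega>) = map q ?bl" using q by (rule sorted_block_rows)
  interpret diagram ?n ?L "\<lambda>i. map q ?bl ! i" row col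
    using diagram_boxes[of ?\<omega>] unfolding srt row_def col_def by simp
  have bl_in: "?bl ! i \<in> {1..m}" if "i < ?L" for i
    using nth_mem[OF that] set_block_rows[of m p] by blast
  define col_of where "col_of \<alpha> \<psi> u = Max (\<psi> ` {w \<in> cycles k \<alpha>. w \<inter> u \<noteq> {}})"
    for \<alpha> and \<psi> :: "nat set \<Rightarrow> nat" and u
  have main: "card {f \<in> {1..k} \<rightarrow>\<^sub>E {1..?n}. \<alpha> \<in> stab k (row \<circ> f) \<and> \<alpha> \<circ> \<beta> \<in> stab k (col \<circ> f)}
     = (\<Sum>\<psi>\<in>cycles k \<alpha> \<rightarrow>\<^sub>E {1..m}. (\<Prod>w\<in>cycles k \<alpha>. p (\<psi> w)) *
          (\<Prod>u\<in>cycles k (\<alpha> \<circ> \<beta>). q (col_of \<alpha> \<psi> u)))" if \<alpha>: "\<alpha> \<in> Sym k" for \<alpha>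
  proof -
    let ?R = "cycles k \<alpha> \<rightarrow>\<^sub>E {..<?L}"
    let ?C = "cycles k \<alpha> \<rightarrow>\<^sub>E {1..m}"
    let ?U = "cycles k (\<alpha> \<circ> \<beta>)"
    \<comment> \<open>\<open>B\<close> remembers only the block of each chosen row.\<close>
    define B where "B \<rho> = (\<lambda>w\<in>cycles k \<alpha>. ?bl ! \<rho> w)" for \<rho>
    have \<gamma>: "\<alpha> \<circ> \<beta> \<in> Sym k" by (rule Sym_comp[OF \<alpha> \<beta>])
    have fin: "finite ?R" "finite ?C" by (auto intro!: finite_PiE)
    have B_in: "B \<rho> \<in> ?C" if "\<rho> \<in> ?R" for \<rho>
      using that bl_in unfolding B_def by fastforce
    have "card {f \<in> {1..k} \<rightarrow>\<^sub>E {1..?n}. \<alpha> \<in> stab k (row \<circ> f) \<and> \<alpha> \<circ> \<beta> \<in> stab k (col \<circ> f)}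
      = (\<Sum>\<rho>\<in>?R. \<Prod>u\<in>?U. q (col_of \<alpha> (B \<rho>) u))"
    proof (rule card_compatible_functions[OF \<alpha> \<gamma>])
      fix \<rho> u j assume \<rho>: "\<rho> \<in> ?R" and u: "u \<in> ?U"
      have sub: "u \<subseteq> {1..k}" "u \<noteq> {}"
        using in_cycles_iff[OF \<gamma> u] cycles_nonempty[OF \<gamma> u] by blast+
      have oc: "orbit \<alpha> x \<in> cycles k \<alpha>" if "x \<in> u" for x
        using that sub by (intro orbit_in_cycles) blast
      have S: "B \<rho> ` {w \<in> cycles k \<alpha>. w \<inter> u \<noteq> {}} = (\<lambda>x. B \<rho> (orbit \<alpha> x)) ` u"
        unfolding cycles_meeting[OF \<alpha> sub(1)] by (simp add: image_image)
      have "finite u" using sub(1) finite_subset by blast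
      then have "j < q (col_of \<alpha> (B \<rho>) u) \<longleftrightarrow> (\<forall>s\<in>(\<lambda>x. B \<rho> (orbit \<alpha> x)) ` u. j < q s)"
        unfolding col_of_def S using sub(2) B_in[OF \<rho>] oc
        by (intro less_antitone_Max_iff[where A = "{1..m}"] q) (blast | simp)+
      also have "\<dots> \<longleftrightarrow> (\<forall>x\<in>u. j < map q ?bl ! \<rho> (orbit \<alpha> x))"
        unfolding ball_simps
      proof (intro ball_cong refl)
        fix x assume x: "x \<in> u"
        then have "\<rho> (orbit \<alpha> x) < ?L" using \<rho> oc by blast
        then show "j < q (B \<rho> (orbit \<alpha> x)) \<longleftrightarrow> j < map q ?bl ! \<rho> (orbit \<alpha> x)"
          using oc[OF x] by (simp add: B_def)
      qed
      finally show "j < q (col_of \<alpha> (B \<rho>) u) \<longleftrightarrow> (\<forall>x\<in>u. j < map q ?bl ! \<rho> (orbit \<alpha> x))" .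
    qed
    also have "\<dots> = (\<Sum>\<psi>\<in>?C. \<Sum>\<rho>\<in>{\<rho> \<in> ?R. B \<rho> = \<psi>}. \<Prod>u\<in>?U. q (col_of \<alpha> (B \<rho>) u))"
      using B_in by (intro sum.group[symmetric] fin) blast
    also have "\<dots> = (\<Sum>\<psi>\<in>?C. (\<Prod>w\<in>cycles k \<alpha>. p (\<psi> w)) * (\<Prod>u\<in>?U. q (col_of \<alpha> \<psi> u)))"
    proof (rule sum.cong[OF refl])
      fix \<psi> assume \<psi>: "\<psi> \<in> ?C"
      \<comment> \<open>The fibre over a colouring is a product over cycles, with
        \<open>p (\<psi> w)\<close> rows to choose from at \<open>w\<close>; the column bound is
        constant on it.\<close>
      have "{\<rho> \<in> ?R. B \<rho> = \<psi>} = (\<Pi>\<^sub>E w\<in>cycles k \<alpha>. {i \<in> {..<?L}. ?bl ! i = \<psi> w})"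
        using \<psi> by (auto simp: B_def PiE_iff fun_eq_iff restrict_def extensional_def)
      then have "card {\<rho> \<in> ?R. B \<rho> = \<psi>} = (\<Prod>w\<in>cycles k \<alpha>. card {i \<in> {..<?L}. ?bl ! i = \<psi> w})"
        by (simp only: card_PiE[OF finite_cycles])
      also have "\<dots> = (\<Prod>w\<in>cycles k \<alpha>. p (\<psi> w))"
        using \<psi> by (intro prod.cong refl card_block_rows) blast
      finally show "(\<Sum>\<rho>\<in>{\<rho> \<in> ?R. B \<rho> = \<psi>}. \<Prod>u\<in>?U. q (col_of \<alpha> (B \<rho>) u))
        = (\<Prod>w\<in>cycles k \<alpha>. p (\<psi> w)) * (\<Prod>u\<in>?U. q (col_of \<alpha> \<psi> u))" by simp
    qed
    finally show ?thesis .
  qed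
  have cm: "(\<Prod>u\<in>cycles k (\<alpha> \<circ> \<beta>). q (snd (coloured_mult k (\<alpha>, \<psi>) \<beta>) u))
      = (\<Prod>u\<in>cycles k (\<alpha> \<circ> \<beta>). q (col_of \<alpha> \<psi> u))" for \<alpha> \<psi>
    by (rule prod.cong) (auto simp: col_of_def)
  have "normalized_char ?\<omega> \<mu> = (\<Sum>f\<in>{1..k} \<rightarrow>\<^sub>E {1..?n}. signed_sum k \<beta> f)"
    unfolding row_def col_def by (rule normalized_char_eq_signed_sum[OF k \<beta> \<mu>])
  also have "\<dots> = (\<Sum>\<alpha>\<in>Sym k. \<Sum>\<psi>\<in>cycles k \<alpha> \<rightarrow>\<^sub>E {1..m}. of_int (sign (\<alpha> \<circ> \<beta>)) *
     of_nat ((\<Prod>w\<in>cycles k \<alpha>. p (\<psi> w)) * (\<Prod>u\<in>cycles k (\<alpha> \<circ> \<beta>). q (snd (coloured_mult k (\<alpha>, \<psi>) \<beta>) u))))"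
    unfolding sum_signed_sum cm
    by (intro sum.cong refl) (simp only: main of_nat_sum sum_distrib_left)
  also have "\<dots> = (\<Sum>(\<alpha>, \<psi>)\<in>coloured_perms k m. of_int (sign (\<alpha> \<circ> \<beta>)) *
     of_nat ((\<Prod>w\<in>cycles k \<alpha>. p (\<psi> w)) * (\<Prod>u\<in>cycles k (\<alpha> \<circ> \<beta>). q (snd (coloured_mult k (\<alpha>, \<psi>) \<beta>) u))))"
    unfolding coloured_perms_def by (rule sum.Sigma) (auto intro!: finite_PiE)
  finally show ?thesis by (simp only: case_prod_beta' prod.collapse)
qed

subsection \<open>Evaluation, degree and top terms\<close>

definition monom_eval :: "('v \<Rightarrow> 'b) \<Rightarrow> ('v \<Rightarrow>\<^sub>0 nat) \<Rightarrow> 'b::comm_ring_1" where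
  "monom_eval x t = (\<Prod>v\<in>Poly_Mapping.keys t. x v ^ Poly_Mapping.lookup t v)"

lemma monom_eval_superset:
  assumes "finite V" "Poly_Mapping.keys t \<subseteq> V"
  shows "monom_eval x t = (\<Prod>v\<in>V. x v ^ Poly_Mapping.lookup t v)"
  unfolding monom_eval_def using assms
  by (intro prod.mono_neutral_left) (auto simp: in_keys_iff)

lemma monom_eval_zero: "monom_eval x 0 = 1"
  by (simp add: monom_eval_def)

lemma monom_eval_add: "monom_eval x (s + t) = monom_eval x s * monom_eval x t"
proof -
  let ?V = "Poly_Mapping.keys s \<union> Poly_Mapping.keys t"
  have "monom_eval x (s + t) = (\<Prod>v\<in>?V. x v ^ Poly_Mapping.lookup (s + t) v)"
    by (rule monom_eval_superset) (simp_all add: Poly_Mapping.keys_add)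
  also have "\<dots> = monom_eval x s * monom_eval x t"
    by (simp add: lookup_add power_add prod.distrib monom_eval_superset[of ?V])
  finally show ?thesis .
qed

lemma monom_eval_single: "monom_eval x (Poly_Mapping.single v c) = x v ^ c"
  by (cases "c = 0") (simp_all add: monom_eval_def)

lemma monom_eval_sum: "monom_eval x (\<Sum>i\<in>I. t i) = (\<Prod>i\<in>I. monom_eval x (t i))"
  by (induction I rule: infinite_finite_induct) (simp_all add: monom_eval_zero monom_eval_add)

lemma monom_deg_superset:
  assumes "finite V" "Poly_Mapping.keys t \<subseteq> V"
  shows "monom_deg t = (\<Sum>v\<in>V. Poly_Mapping.lookup t v)"
  unfolding monom_deg_def using assms
  by (intro sum.mono_neutral_left) (auto simp: in_keys_iff)

lemma monom_deg_add: "monom_deg (s + t) = monom_deg s + monom_deg t"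
proof -
  let ?V = "Poly_Mapping.keys s \<union> Poly_Mapping.keys t"
  have "monom_deg (s + t) = (\<Sum>v\<in>?V. Poly_Mapping.lookup (s + t) v)"
    by (rule monom_deg_superset) (simp_all add: Poly_Mapping.keys_add)
  also have "\<dots> = monom_deg s + monom_deg t"
    by (simp add: lookup_add sum.distrib monom_deg_superset[of ?V])
  finally show ?thesis .
qed

lemma monom_deg_single: "monom_deg (Poly_Mapping.single v c) = c"
  by (cases "c = 0") (simp_all add: monom_deg_def)

lemma monom_deg_sum: "monom_deg (\<Sum>i\<in>I. t i) = (\<Sum>i\<in>I. monom_deg (t i))"
proof (induction I rule: infinite_finite_induct)
  case (insert i I)
  then show ?case by (simp add: monom_deg_add)
qed (simp_all add: monom_deg_def)

lemma msubst_superset: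
  assumes "finite K" "Poly_Mapping.keys F \<subseteq> K" "h 0 = 0"
  shows "msubst h x F = (\<Sum>t\<in>K. h (Poly_Mapping.lookup F t) * monom_eval x t)"
  unfolding msubst_def monom_eval_def[symmetric] using assms
  by (intro sum.mono_neutral_left) (auto simp: in_keys_iff)

lemma msubst_add:
  assumes h: "\<And>a b. h (a + b) = h a + h b" "h 0 = 0"
  shows "msubst h x (F + G) = msubst h x F + msubst h x G"
proof -
  let ?K = "Poly_Mapping.keys F \<union> Poly_Mapping.keys G"
  have "msubst h x (F + G) = (\<Sum>t\<in>?K. h (Poly_Mapping.lookup (F + G) t) * monom_eval x t)"
    by (rule msubst_superset) (simp_all add: Poly_Mapping.keys_add h)
  also have "\<dots> = msubst h x F + msubst h x G"
    by (simp add: lookup_add h sum.distrib distrib_right msubst_superset[of ?K])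
  finally show ?thesis .
qed

lemma msubst_single:
  "h 0 = 0 \<Longrightarrow> msubst h x (Poly_Mapping.single t c) = h c * monom_eval x t"
  by (cases "c = 0") (simp_all add: msubst_def monom_eval_def)

lemma msubst_sum_single:
  assumes "\<And>a b. h (a + b) = h a + h b" "h 0 = 0"
  shows "msubst h x (\<Sum>a\<in>A. Poly_Mapping.single (t a) (c a)) = (\<Sum>a\<in>A. h (c a) * monom_eval x (t a))"
proof (induction A rule: infinite_finite_induct)
  case (insert a A)
  then show ?case by (simp add: msubst_add[of h, OF assms] msubst_single[of h, OF assms(2)])
qed (simp_all add: msubst_def)

lemma meval_add: "meval x (F + G) = meval x F + meval x G"
  unfolding meval_def by (rule msubst_add) simp_all

lemma meval_diff: "meval x (F - G) = meval x F - meval x G"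
  using meval_add[of x "F - G" G] by (simp add: algebra_simps)

lemma mvars_diff: "mvars (F - G) \<subseteq> mvars F \<union> mvars G"
  using Poly_Mapping.keys_diff[of F G] by (auto simp: mvars_def)

lemma keys_sum_subset:
  "Poly_Mapping.keys (\<Sum>a\<in>A. f a) \<subseteq> (\<Union>a\<in>A. Poly_Mapping.keys (f a))"
proof (induction A rule: infinite_finite_induct)
  case (insert a A)
  then show ?case using Poly_Mapping.keys_add[of "f a" "sum f A"] by auto
qed simp_all

lemma mvars_sum_single:
  "mvars (\<Sum>a\<in>A. Poly_Mapping.single (t a) (c a)) \<subseteq> (\<Union>a\<in>A. Poly_Mapping.keys (t a))"
  using keys_sum_subset[of "\<lambda>a. Poly_Mapping.single (t a) (c a)" A]
  by (fastforce simp: mvars_def split: if_splits)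

lemma mvar_power: "mvar v ^ c = Poly_Mapping.single (Poly_Mapping.single v c) 1"
proof (induction c)
  case (Suc c)
  then show ?case by (simp add: mvar_def mult_single single_add[symmetric])
qed simp

lemma prod_single_one:
  "(\<Prod>i\<in>I. Poly_Mapping.single (t i) (1::'a::comm_ring_1)) = Poly_Mapping.single (\<Sum>i\<in>I. t i) 1"
  by (induction I rule: infinite_finite_induct) (simp_all add: mult_single)

lemma monom_eval_mvar:
  "monom_eval mvar t = (Poly_Mapping.single t 1 :: ('v, 'a::comm_ring_1) mpoly)"
proof -
  have "(\<Sum>v\<in>Poly_Mapping.keys t. Poly_Mapping.single v (Poly_Mapping.lookup t v)) = t"
    by (rule poly_mapping_eqI)
       (simp add: lookup_sum lookup_single when_def in_keys_iff)
  then show ?thesis by (simp add: monom_eval_def mvar_power prod_single_one)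
qed

lemma lookup_sum_single:
  assumes "finite A"
  shows "Poly_Mapping.lookup (\<Sum>a\<in>A. Poly_Mapping.single (t a) (1::'a::comm_ring_1)) s
    = of_nat (card {a \<in> A. t a = s})"
proof -
  have "Poly_Mapping.lookup (\<Sum>a\<in>A. Poly_Mapping.single (t a) (1::'a)) s = (\<Sum>a\<in>A. if t a = s then 1 else 0)"
    by (simp add: lookup_sum lookup_single when_def)
  also have "\<dots> = (\<Sum>a\<in>{a \<in> A. t a = s}. 1)"
    using assms by (intro sum.mono_neutral_cong_right) auto
  finally show ?thesis by simp
qed

text \<open>The coefficient at \<open>s\<close> is the number of indices with exponent
  \<open>s\<close>, nonzero in characteristic 0 as soon as one exists, so the support is exactly the
  image of \<open>t\<close>. The index \<open>a0\<close> shows that the degree bound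
  \<open>D\<close> is attained.\<close>

lemma top_terms_sum_single:
  fixes t :: "'b \<Rightarrow> 'v \<Rightarrow>\<^sub>0 nat"
  assumes A: "finite A" and le: "\<And>a. a \<in> A \<Longrightarrow> monom_deg (t a) \<le> D"
    and a0: "a0 \<in> A" "monom_deg (t a0) = D"
  shows "top_terms (\<Sum>a\<in>A. Poly_Mapping.single (t a) (1::'a::{comm_ring_1, ring_char_0}))
    = (\<Sum>a\<in>{a \<in> A. monom_deg (t a) = D}. Poly_Mapping.single (t a) 1)"
proof -
  let ?F = "\<Sum>a\<in>A. Poly_Mapping.single (t a) (1::'a)"
  have keys: "Poly_Mapping.keys ?F = t ` A"
    using A by (auto simp: in_keys_iff lookup_sum_single[OF A])
  have "Max (insert 0 (monom_deg ` t ` A)) = D"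
    using A le a0 by (intro Max_eqI) auto
  then have D: "total_deg ?F = D" by (simp add: total_deg_def keys)
  show ?thesis
  proof (rule poly_mapping_eqI)
    fix s
    have "Poly_Mapping.lookup (top_terms ?F) s
      = (\<Sum>u\<in>{u \<in> t ` A. monom_deg u = D}. if u = s then Poly_Mapping.lookup ?F u else 0)"
      unfolding top_terms_def keys D
      by (simp only: lookup_sum[of "\<lambda>u. Poly_Mapping.single u (Poly_Mapping.lookup ?F u)"]
          lookup_single when_def)
    also have "\<dots> = (if s \<in> t ` A \<and> monom_deg s = D then Poly_Mapping.lookup ?F s else 0)"
      using A by (subst sum.delta) auto
    also have "\<dots> = of_nat (card {a \<in> {a \<in> A. monom_deg (t a) = D}. t a = s})"
    proof (cases "monom_deg s = D")
      case True
      then have eq: "{a \<in> {a \<in> A. monom_deg (t a) = D}. t a = s} = {a \<in> A. t a = s}" by auto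
      have "card {a \<in> A. t a = s} = 0" if "s \<notin> t ` A"
      proof -
        have "{a \<in> A. t a = s} = {}" using that by blast
        then show ?thesis by (simp only: card.empty)
      qed
      then show ?thesis unfolding eq lookup_sum_single[OF A] using True by simp
    next
      case False
      then have "{a \<in> {a \<in> A. monom_deg (t a) = D}. t a = s} = {}" by auto
      then show ?thesis using False by (simp only: card.empty) simp
    qed
    also have "\<dots> = Poly_Mapping.lookup (\<Sum>a\<in>{a \<in> A. monom_deg (t a) = D}. Poly_Mapping.single (t a) (1::'a)) s"
      using A by (subst lookup_sum_single) auto
    finally show "Poly_Mapping.lookup (top_terms ?F) s
      = Poly_Mapping.lookup (\<Sum>a\<in>{a \<in> A. monom_deg (t a) = D}. Poly_Mapping.single (t a) (1::'a)) s" .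
  qed
qed

subsection \<open>Uniqueness of the polynomial\<close>

lemma digits_unique:
  fixes f g :: "nat \<Rightarrow> nat"
  assumes "\<And>j. j < M \<Longrightarrow> f j < d" "\<And>j. j < M \<Longrightarrow> g j < d"
    and "(\<Sum>j<M. d ^ j * f j) = (\<Sum>j<M. d ^ j * g j)" and "j < M"
  shows "f j = g j"
  using assms
proof (induction M arbitrary: f g j)
  case (Suc M)
  have shift: "(\<Sum>j<Suc M. d ^ j * h j) = h 0 + d * (\<Sum>j<M. d ^ j * h (Suc j))" for h :: "nat \<Rightarrow> nat"
    by (subst sum.lessThan_Suc_shift) (simp add: sum_distrib_left mult.assoc)
  have eq: "f 0 + d * (\<Sum>j<M. d ^ j * f (Suc j)) = g 0 + d * (\<Sum>j<M. d ^ j * g (Suc j))"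
    using Suc.prems(3) by (simp only: shift)
  have lt: "f 0 < d" "g 0 < d" using Suc.prems by auto
  from arg_cong[OF eq, of "\<lambda>x. x mod d"] have 0: "f 0 = g 0" using lt by simp
  then have "(\<Sum>j<M. d ^ j * f (Suc j)) = (\<Sum>j<M. d ^ j * g (Suc j))" using eq lt by simp
  then have "f (Suc i) = g (Suc i)" if "i < M" for i
    using Suc.prems(1,2) that by (intro Suc.IH[of "\<lambda>j. f (Suc j)" "\<lambda>j. g (Suc j)"]) auto
  then show ?case using 0 Suc.prems(4) by (cases j) auto
qed simp

text \<open>Kronecker substitution: for large \<open>d\<close> the values \<open>N ^ d ^ j\<close> separate the monomials, and
  the enumeration \<open>X\<close> lets us prescribe the order of these values.\<close>

lemma Kronecker_substitution_zero:
  fixes F :: "('v, complex) mpoly"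
  assumes X: "bij_betw X {..<M} V" and FV: "mvars F \<subseteq> V"
    and zero: "\<And>d N. d \<ge> 1 \<Longrightarrow> N \<ge> b \<Longrightarrow>
       meval (\<lambda>v. of_nat (N ^ d ^ the_inv_into {..<M} X v)) F = 0"
  shows "F = 0"
proof (rule ccontr)
  assume "F \<noteq> 0"
  then obtain t0 where t0: "t0 \<in> Poly_Mapping.keys F"
    by (metis poly_mapping_eqI in_keys_iff lookup_zero)
  let ?K = "Poly_Mapping.keys F"
  let ?l = "Poly_Mapping.lookup"
  have finV: "finite V" using bij_betw_finite[OF X] by simp
  \<comment> \<open>\<open>d\<close> exceeds every exponent in \<open>F\<close>, so exponents can
    serve as digits in base \<open>d\<close>; inserting 0 keeps \<open>Max\<close> meaningful when
    \<open>V\<close> is empty.\<close>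
  define d where "d = Suc (Max (insert 0 ((\<lambda>(t, v). ?l t v) ` (?K \<times> V))))"
  have ltd: "?l t v < d" if "t \<in> ?K" "v \<in> V" for t v
    unfolding d_def using that finV by (intro le_imp_less_Suc Max_ge) (auto intro!: image_eqI[of _ _ "(t, v)"])
  \<comment> \<open>At the point of the substitution the monomial \<open>t\<close> takes the value
    \<open>N ^ w t\<close>.\<close>
  define w where "w t = (\<Sum>j<M. d ^ j * ?l t (X j))" for t :: "'v \<Rightarrow>\<^sub>0 nat"
  have XV: "X j \<in> V" if "j < M" for j using that bij_betwE[OF X] by blast
  have keysV: "Poly_Mapping.keys t \<subseteq> V" if "t \<in> ?K" for t
    using that FV by (auto simp: mvars_def)
  have w_inj: "s = t" if "s \<in> ?K" "t \<in> ?K" "w s = w t" for s t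
  proof (rule poly_mapping_eqI)
    fix v
    show "?l s v = ?l t v"
    proof (cases "v \<in> V")
      case True
      then obtain j where "j < M" "v = X j" using X unfolding bij_betw_def by blast
      then show ?thesis
        using digits_unique[of M "\<lambda>j. ?l s (X j)" d "\<lambda>j. ?l t (X j)" j] that XV ltd
        unfolding w_def by blast
    next
      case False
      then show ?thesis using keysV[OF that(1)] keysV[OF that(2)] by (metis in_keys_iff subsetD)
    qed
  qed
  define f where "f = (\<Sum>t\<in>?K. Polynomial.monom (?l F t) (w t))"
  have "poly f (of_nat N) = 0" if "N \<ge> b" for N
  proof -
    have "monom_eval (\<lambda>v. of_nat (N ^ d ^ the_inv_into {..<M} X v)) t = (of_nat N ^ w t :: complex)"
      if "t \<in> ?K" for t
    proof -
      have "monom_eval (\<lambda>v. of_nat (N ^ d ^ the_inv_into {..<M} X v)) t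
        = (\<Prod>v\<in>V. of_nat (N ^ d ^ the_inv_into {..<M} X v) ^ ?l t v :: complex)"
        by (rule monom_eval_superset[OF finV keysV[OF that]])
      also have "\<dots> = (\<Prod>j<M. of_nat (N ^ d ^ the_inv_into {..<M} X (X j)) ^ ?l t (X j))"
        by (rule prod.reindex_bij_betw[OF X, symmetric])
      also have "\<dots> = (\<Prod>j<M. of_nat N ^ (d ^ j * ?l t (X j)))"
        by (intro prod.cong refl)
           (simp add: the_inv_into_f_f[OF bij_betw_imp_inj_on[OF X]] power_mult)
      finally show ?thesis by (simp add: w_def power_sum)
    qed
    then have "poly f (of_nat N) = meval (\<lambda>v. of_nat (N ^ d ^ the_inv_into {..<M} X v)) F"
      by (simp add: f_def poly_sum poly_monom meval_def msubst_def monom_eval_def[symmetric])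
    also have "\<dots> = 0" using that by (intro zero) (simp_all add: d_def)
    finally show ?thesis .
  qed
  then have "of_nat ` {b..} \<subseteq> {z. poly f z = 0}" by auto
  moreover have "infinite (of_nat ` {b..} :: complex set)"
    using infinite_Ici[of b] by (simp add: finite_image_iff)
  ultimately have "f = 0" using poly_roots_finite[of f] finite_subset by blast
  \<comment> \<open>Distinct monomials have distinct weights, so nothing but \<open>t0\<close>
    contributes here.\<close>
  have "coeff f (w t0) = (\<Sum>t\<in>?K. if t = t0 then ?l F t else 0)"
    unfolding f_def coeff_sum coeff_monom using w_inj[OF _ t0] by (intro sum.cong refl) auto
  then have "coeff f (w t0) = ?l F t0" using t0 by simp
  then show False using \<open>f = 0\<close> t0 by (simp add: in_keys_iff)
qed

lemma stanley_char_poly_unique: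
  assumes m: "m \<ge> 1" and F: "is_stanley_char_poly m \<mu> F" and G: "is_stanley_char_poly m \<mu> G"
  shows "F = G"
proof -
  \<comment> \<open>The variables are listed as q_m, ..., q_1, p_1, ..., p_m. Values grow along the
    list, so \<open>q i\<close> becomes \<open>N ^ d ^ (m - i)\<close>, weakly decreasing in
    \<open>i\<close> as a shape requires.\<close>
  define X where "X j = (if j < m then Var_q (m - j) else Var_p (Suc (j - m)))" for j
  let ?V = "Var_p ` {1..m} \<union> Var_q ` {1..m}"
  have inj: "inj_on X {..<2 * m}"
    by (auto simp: inj_on_def X_def split: if_splits)
  have Xq: "Var_q i = X (m - i)" "m - i < 2 * m" and Xp: "Var_p i = X (m + i - 1)" "m + i - 1 < 2 * m"
    if "i \<in> {1..m}" for i using that by (auto simp: X_def)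
  have "X ` {..<2 * m} = ?V"
  proof
    show "X ` {..<2 * m} \<subseteq> ?V" using m by (auto simp: X_def)
    show "?V \<subseteq> X ` {..<2 * m}" using Xq Xp by blast
  qed
  then have X: "bij_betw X {..<2 * m} ?V" using inj by (simp add: bij_betw_def)
  \<comment> \<open>The threshold \<open>b\<close> keeps all values positive and makes
    \<open>q 1\<close>, which is at least \<open>N\<close>, large enough for the size condition by
    itself.\<close>
  have "F - G = 0"
  proof (rule Kronecker_substitution_zero[OF X, where b = "Suc (\<Sum>\<^sub># \<mu>)"])
    show "mvars (F - G) \<subseteq> ?V"
      using F G mvars_diff[of F G] unfolding is_stanley_char_poly_def by blast
    fix d N :: nat assume d: "d \<ge> 1" and N: "N \<ge> Suc (\<Sum>\<^sub># \<mu>)"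
    let ?x = "\<lambda>v. N ^ d ^ the_inv_into {..<2 * m} X v"
    define p where "p i = ?x (Var_p i)" for i
    define q where "q i = ?x (Var_q i)" for i
    have q: "q i = N ^ d ^ (m - i)" if "i \<in> {1..m}" for i
      using Xq[OF that] the_inv_into_f_f[OF inj, of "m - i"] by (simp add: q_def)
    have pos: "0 < p i" "0 < q i" for i using N by (auto simp: p_def q_def)
    have anti: "q j \<le> q i" if "i \<in> {1..m}" "j \<in> {1..m}" "i \<le> j" for i j
      unfolding q[OF that(1)] q[OF that(2)] using N d that by (intro power_increasing) auto
    have "\<Sum>\<^sub># \<mu> \<le> N ^ 1" using N by simp
    also have "\<dots> \<le> N ^ d ^ (m - 1)" using N d by (intro power_increasing) auto
    also have "\<dots> = q 1" using m by (subst q) auto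
    also have "\<dots> \<le> p 1 * q 1" using pos[of 1] by simp
    also have "\<dots> \<le> (\<Sum>i\<in>{1..m}. p i * q i)" using m by (intro member_le_sum) auto
    finally have size: "\<Sum>\<^sub># \<mu> \<le> (\<Sum>i\<in>{1..m}. p i * q i)" .
    have *: "meval (\<lambda>v. case v of Var_p i \<Rightarrow> of_nat (p i) | Var_q i \<Rightarrow> of_nat (q i)) H
        = normalized_char (shape m p q) \<mu>" if "is_stanley_char_poly m \<mu> H" for H
      using that pos anti size unfolding is_stanley_char_poly_def by blast
    have "(\<lambda>v. case v of Var_p i \<Rightarrow> of_nat (p i) | Var_q i \<Rightarrow> of_nat (q i)) = (\<lambda>v. of_nat (?x v) :: complex)"
      by (auto simp: p_def q_def fun_eq_iff split: pq_var.split)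
    then show "meval (\<lambda>v. of_nat (?x v)) (F - G) = 0"
      using *[OF F] *[OF G] by (simp add: meval_diff)
  qed
  then show ?thesis by simp
qed

subsection \<open>The coloured expansion\<close>

definition colour_exp :: "nat \<Rightarrow> nat \<Rightarrow> (nat \<Rightarrow> pq_var) \<Rightarrow>
    (nat \<Rightarrow> nat) \<times> (nat set \<Rightarrow> nat) \<Rightarrow> pq_var \<Rightarrow>\<^sub>0 nat" where
  "colour_exp k m X a = (\<Sum>i\<in>{1..m}. Poly_Mapping.single (X i) (colour_count k i a))"

lemma colour_monom_eq_single: "colour_monom k m X a = Poly_Mapping.single (colour_exp k m X a) 1"
  by (simp add: colour_monom_def colour_exp_def mvar_power prod_single_one)

lemma prod_colour_count:
  fixes g :: "nat \<Rightarrow> 'b::comm_monoid_mult"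
  assumes "snd a ` cycles k (fst a) \<subseteq> {1..m}"
  shows "(\<Prod>i\<in>{1..m}. g i ^ colour_count k i a) = (\<Prod>u\<in>cycles k (fst a). g (snd a u))"
proof -
  have "(\<Prod>u\<in>cycles k (fst a). g (snd a u))
      = (\<Prod>i\<in>{1..m}. \<Prod>u\<in>{u \<in> cycles k (fst a). snd a u = i}. g (snd a u))"
    by (rule prod.group[symmetric]) (use assms in auto)
  also have "\<dots> = (\<Prod>i\<in>{1..m}. g i ^ colour_count k i a)"
    by (intro prod.cong refl) (cases a, simp)
  finally show ?thesis ..
qed

lemma monom_eval_colour_exp:
  assumes "snd a ` cycles k (fst a) \<subseteq> {1..m}"
  shows "monom_eval x (colour_exp k m X a) = (\<Prod>u\<in>cycles k (fst a). x (X (snd a u)))"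
  using prod_colour_count[OF assms, of "\<lambda>i. x (X i)"]
  by (simp add: colour_exp_def monom_eval_sum monom_eval_single)

lemma monom_deg_colour_exp:
  assumes "snd a ` cycles k (fst a) \<subseteq> {1..m}"
  shows "monom_deg (colour_exp k m X a) = num_cycles k (fst a)"
proof -
  have "num_cycles k (fst a) = (\<Sum>u\<in>cycles k (fst a). 1)" by (simp add: num_cycles_def)
  also have "\<dots> = (\<Sum>i\<in>{1..m}. \<Sum>u\<in>{u \<in> cycles k (fst a). snd a u = i}. 1)"
    by (rule sum.group[symmetric]) (use assms in auto)
  also have "\<dots> = (\<Sum>i\<in>{1..m}. colour_count k i a)"
    by (intro sum.cong refl) (cases a, simp)
  finally show ?thesis by (simp add: colour_exp_def monom_deg_sum monom_deg_single)
qed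

lemma keys_colour_exp: "Poly_Mapping.keys (colour_exp k m X a) \<subseteq> X ` {1..m}"
  unfolding colour_exp_def using keys_sum_subset by (fastforce split: if_splits)

lemma fst_coloured_mult: "fst (coloured_mult k a \<beta>) = fst a \<circ> \<beta>"
  by (cases a) simp

lemma coloured_perms_Sym: "a \<in> coloured_perms k m \<Longrightarrow> fst a \<in> Sym k"
  by (auto simp: coloured_perms_def)

lemma coloured_perms_colours: "a \<in> coloured_perms k m \<Longrightarrow> snd a ` cycles k (fst a) \<subseteq> {1..m}"
  by (auto simp: coloured_perms_def PiE_iff)

lemma finite_coloured_perms: "finite (coloured_perms k m)"
  unfolding coloured_perms_def by (intro finite_SigmaI finite_PiE) auto

text \<open>Every cycle of the product meets some cycle of the first factor, so the maximum is over
  a nonempty set of colours.\<close>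

lemma coloured_mult_colours:
  assumes a: "a \<in> coloured_perms k m" and \<beta>: "\<beta> \<in> Sym k"
  shows "snd (coloured_mult k a \<beta>) ` cycles k (fst a \<circ> \<beta>) \<subseteq> {1..m}"
proof (rule image_subsetI)
  fix u assume u: "u \<in> cycles k (fst a \<circ> \<beta>)"
  let ?W = "{w \<in> cycles k (fst a). w \<inter> u \<noteq> {}}"
  have \<alpha>: "fst a \<in> Sym k" by (rule coloured_perms_Sym[OF a])
  have sub: "u \<subseteq> {1..k}" "u \<noteq> {}"
    using in_cycles_iff[OF Sym_comp[OF \<alpha> \<beta>] u] cycles_nonempty[OF Sym_comp[OF \<alpha> \<beta>] u] by blast+
  then have "?W \<noteq> {}" unfolding cycles_meeting[OF \<alpha> sub(1)] by blast
  then have "Max (snd a ` ?W) \<in> snd a ` ?W" by (intro Max_in) auto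
  also have "\<dots> \<subseteq> {1..m}" using coloured_perms_colours[OF a] by blast
  finally show "snd (coloured_mult k a \<beta>) u \<in> {1..m}" using u by (cases a) simp
qed

definition coloured_exp :: "nat \<Rightarrow> nat \<Rightarrow> (nat \<Rightarrow> nat) \<Rightarrow>
    (nat \<Rightarrow> nat) \<times> (nat set \<Rightarrow> nat) \<Rightarrow> pq_var \<Rightarrow>\<^sub>0 nat" where
  "coloured_exp k m \<beta> a = colour_exp k m Var_p a + colour_exp k m Var_q (coloured_mult k a \<beta>)"

lemma colour_monoms_eq_single:
  "colour_monom k m Var_p a * colour_monom k m Var_q (coloured_mult k a \<beta>)
    = Poly_Mapping.single (coloured_exp k m \<beta> a) 1"
  by (simp add: colour_monom_eq_single coloured_exp_def mult_single)

lemma monom_deg_coloured_exp: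
  assumes a: "a \<in> coloured_perms k m" and \<beta>: "\<beta> \<in> Sym k"
  shows "monom_deg (coloured_exp k m \<beta> a) = num_cycles k (fst a) + num_cycles k (fst a \<circ> \<beta>)"
  using monom_deg_colour_exp[OF coloured_perms_colours[OF a], of Var_p]
    monom_deg_colour_exp[of "coloured_mult k a \<beta>" k m Var_q] coloured_mult_colours[OF assms]
  by (simp add: coloured_exp_def monom_deg_add fst_coloured_mult)

lemma monom_eval_coloured_exp:
  assumes a: "a \<in> coloured_perms k m" and \<beta>: "\<beta> \<in> Sym k"
  shows "monom_eval x (coloured_exp k m \<beta> a) = (\<Prod>w\<in>cycles k (fst a). x (Var_p (snd a w))) *
    (\<Prod>u\<in>cycles k (fst a \<circ> \<beta>). x (Var_q (snd (coloured_mult k a \<beta>) u)))"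
  using monom_eval_colour_exp[OF coloured_perms_colours[OF a], of x Var_p]
    monom_eval_colour_exp[of "coloured_mult k a \<beta>" k m x Var_q] coloured_mult_colours[OF assms]
  by (simp add: coloured_exp_def monom_eval_add fst_coloured_mult)

text \<open>The existence half: at integer points each monomial becomes a product over cycles, and
  the sum is the formula of \<open>normalized_char_shape\<close>.\<close>

lemma is_stanley_char_poly_coloured:
  assumes \<beta>: "\<beta> \<in> Sym k" and \<mu>: "cycle_type k \<beta> = \<mu>" "\<Sum>\<^sub># \<mu> = k"
  shows "is_stanley_char_poly m \<mu> (\<Sum>a\<in>coloured_perms k m.
    Poly_Mapping.single (coloured_exp k m \<beta> a) (of_int (sign (fst a \<circ> \<beta>))))"
    (is "is_stanley_char_poly m \<mu> ?F")
  unfolding is_stanley_char_poly_def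
proof (intro conjI allI impI)
  have "Poly_Mapping.keys (coloured_exp k m \<beta> a) \<subseteq> Var_p ` {1..m} \<union> Var_q ` {1..m}" for a
    unfolding coloured_exp_def
    using Poly_Mapping.keys_add[of "colour_exp k m Var_p a" "colour_exp k m Var_q (coloured_mult k a \<beta>)"]
      keys_colour_exp[of k m Var_p a] keys_colour_exp[of k m Var_q "coloured_mult k a \<beta>"] by blast
  then show "mvars ?F \<subseteq> Var_p ` {1..m} \<union> Var_q ` {1..m}"
    by (intro subset_trans[OF mvars_sum_single]) blast
  fix p q :: "nat \<Rightarrow> nat"
  assume *: "(\<forall>i\<in>{1..m}. 0 < p i \<and> 0 < q i) \<and> (\<forall>i\<in>{1..m}. \<forall>j\<in>{1..m}. i \<le> j \<longrightarrow> q j \<le> q i) \<and>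
    \<Sum>\<^sub># \<mu> \<le> (\<Sum>i\<in>{1..m}. p i * q i)"
  let ?x = "\<lambda>v. case v of Var_p i \<Rightarrow> of_nat (p i) | Var_q i \<Rightarrow> (of_nat (q i) :: complex)"
  have "\<Sum>\<^sub># (shape m p q) = (\<Sum>i\<in>{1..m}. p i * q i)"
    unfolding shape_def by (induction m) auto
  then have k: "k \<le> \<Sum>\<^sub># (shape m p q)" using * \<mu>(2) by simp
  have "meval ?x ?F = (\<Sum>a\<in>coloured_perms k m. of_int (sign (fst a \<circ> \<beta>)) * monom_eval ?x (coloured_exp k m \<beta> a))"
    unfolding meval_def by (subst msubst_sum_single) simp_all
  also have "\<dots> = (\<Sum>a\<in>coloured_perms k m. of_int (sign (fst a \<circ> \<beta>)) *
     of_nat ((\<Prod>w\<in>cycles k (fst a). p (snd a w)) *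
             (\<Prod>u\<in>cycles k (fst a \<circ> \<beta>). q (snd (coloured_mult k a \<beta>) u))))"
    by (intro sum.cong refl) (simp add: monom_eval_coloured_exp[OF _ \<beta>])
  also have "\<dots> = normalized_char (shape m p q) \<mu>"
    by (rule normalized_char_shape[OF _ \<beta> \<mu> k, symmetric]) (use * in blast)
  finally show "meval ?x ?F = normalized_char (shape m p q) \<mu>" .
qed

lemma stanley_char_poly_eq:
  assumes "m \<ge> 1" "\<beta> \<in> Sym k" "cycle_type k \<beta> = \<mu>" "\<Sum>\<^sub># \<mu> = k"
  shows "stanley_char_poly m \<mu> = (\<Sum>a\<in>coloured_perms k m.
    Poly_Mapping.single (coloured_exp k m \<beta> a) (of_int (sign (fst a \<circ> \<beta>))))"
  unfolding stanley_char_poly_def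
  by (rule the_equality[where P = "is_stanley_char_poly m \<mu>", OF is_stanley_char_poly_coloured[OF assms(2-4)]])
     (rule stanley_char_poly_unique[OF assms(1) _ is_stanley_char_poly_coloured[OF assms(2-4)]])

lemma negate_q_stanley_char_poly:
  assumes "m \<ge> 1" and \<beta>: "\<beta> \<in> Sym k" and "cycle_type k \<beta> = \<mu>" "\<Sum>\<^sub># \<mu> = k"
  shows "(- 1) ^ k * negate_q (stanley_char_poly m \<mu>) = (\<Sum>a\<in>coloured_perms k m.
    Poly_Mapping.single (coloured_exp k m \<beta> a) 1)"
proof -
  let ?x = "\<lambda>v. case v of Var_p i \<Rightarrow> mvar (Var_p i) | Var_q i \<Rightarrow> (- mvar (Var_q i) :: (pq_var, complex) mpoly)"
  have "negate_q (stanley_char_poly m \<mu>) = (\<Sum>a\<in>coloured_perms k m.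
      mconst (of_int (sign (fst a \<circ> \<beta>))) * monom_eval ?x (coloured_exp k m \<beta> a))"
    unfolding negate_q_def stanley_char_poly_eq[OF assms]
    by (rule msubst_sum_single) (simp_all add: mconst_def single_add)
  then have "(- 1) ^ k * negate_q (stanley_char_poly m \<mu>) = (\<Sum>a\<in>coloured_perms k m.
      (- 1) ^ k * (mconst (of_int (sign (fst a \<circ> \<beta>))) * monom_eval ?x (coloured_exp k m \<beta> a)))"
    by (simp only: sum_distrib_left)
  also have "\<dots> = (\<Sum>a\<in>coloured_perms k m. Poly_Mapping.single (coloured_exp k m \<beta> a) 1)"
  proof (rule sum.cong[OF refl])
    fix a assume a: "a \<in> coloured_perms k m"
    let ?\<gamma> = "fst a \<circ> \<beta>" and ?c = "num_cycles k (fst a \<circ> \<beta>)"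
    have \<gamma>: "?\<gamma> \<in> Sym k" by (rule Sym_comp[OF coloured_perms_Sym[OF a] \<beta>])
    have "monom_eval ?x (coloured_exp k m \<beta> a) = (- 1) ^ ?c *
        monom_eval mvar (coloured_exp k m \<beta> a)"
    proof -
      have "(\<Prod>u\<in>cycles k ?\<gamma>. - mvar (Var_q (snd (coloured_mult k a \<beta>) u)) :: (pq_var, complex) mpoly)
        = (- 1) ^ ?c * (\<Prod>u\<in>cycles k ?\<gamma>. mvar (Var_q (snd (coloured_mult k a \<beta>) u)))"
        by (simp add: prod_uminus num_cycles_def)
      then show ?thesis by (simp add: monom_eval_coloured_exp[OF a \<beta>])
    qed
    also have "monom_eval mvar (coloured_exp k m \<beta> a) = Poly_Mapping.single (coloured_exp k m \<beta> a) (1 :: complex)"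
      by (rule monom_eval_mvar)
    finally have e: "monom_eval ?x (coloured_exp k m \<beta> a) = (- 1) ^ ?c * Poly_Mapping.single (coloured_exp k m \<beta> a) 1" .
    have "mconst (of_int (sign ?\<gamma>)) = ((- 1) ^ (k - ?c) :: (pq_var, complex) mpoly)"
      unfolding sign_num_cycles[OF \<gamma>]
      by (cases "even (k - ?c)") (simp_all add: mconst_def single_uminus)
    then have "(- 1) ^ k * (mconst (of_int (sign ?\<gamma>)) * monom_eval ?x (coloured_exp k m \<beta> a))
        = (- 1) ^ (k + ((k - ?c) + ?c)) * Poly_Mapping.single (coloured_exp k m \<beta> a) 1"
      by (simp only: e power_add mult.assoc)
    \<comment> \<open>Contributions to the sign: \<open>k\<close> from the prefactor,
      \<open>k - ?c\<close> from the sign of the product, \<open>?c\<close> from the negated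
      \<open>q\<close>. The subtraction is exact because \<open>?c\<close> is at most
      \<open>k\<close>.\<close>
    also have "k + ((k - ?c) + ?c) = 2 * k" using num_cycles_le[of k ?\<gamma>] by simp
    also have "(- 1) ^ (2 * k) = (1 :: (pq_var, complex) mpoly)"
      by (simp only: power_mult power2_minus one_power2 power_one)
    finally show "(- 1) ^ k * (mconst (of_int (sign ?\<gamma>)) * monom_eval ?x (coloured_exp k m \<beta> a))
        = Poly_Mapping.single (coloured_exp k m \<beta> a) 1" by (simp only: mult_1)
  qed
  finally show ?thesis .
qed

theorem mainTheorem2:
  fixes m k :: nat and \<mu> :: "nat multiset" and \<omega>\<^sub>\<mu> :: "nat \<Rightarrow> nat"
  assumes "m \<ge> 1" and "k \<ge> 1"
    and "is_partition \<mu> k"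
    and "\<omega>\<^sub>\<mu> \<in> Sym k" and "cycle_type k \<omega>\<^sub>\<mu> = \<mu>"
  shows "top_terms ((- 1) ^ k * negate_q (stanley_char_poly m \<mu>))
           = top_terms (\<Sum>a \<in> coloured_perms k m.
               colour_monom k m Var_p a * colour_monom k m Var_q (coloured_mult k a \<omega>\<^sub>\<mu>))
       \<and> top_terms ((- 1) ^ k * negate_q (stanley_char_poly m \<mu>))
           = (\<Sum>a \<in> {a \<in> coloured_perms k m.
                 num_cycles k (fst a) + num_cycles k (fst a \<circ> \<omega>\<^sub>\<mu>) = k + size \<mu>}.
               colour_monom k m Var_p a * colour_monom k m Var_q (coloured_mult k a \<omega>\<^sub>\<mu>))"
proof -
  let ?t = "coloured_exp k m \<omega>\<^sub>\<mu>"
  have \<mu>: "\<Sum>\<^sub># \<mu> = k" using assms(3) by (simp add: is_partition_def)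
  have F: "(- 1) ^ k * negate_q (stanley_char_poly m \<mu>) = (\<Sum>a\<in>coloured_perms k m. Poly_Mapping.single (?t a) 1)"
    by (rule negate_q_stanley_char_poly[OF assms(1,4,5) \<mu>])
  have size: "num_cycles k \<omega>\<^sub>\<mu> = size \<mu>" using size_cycle_type[of k \<omega>\<^sub>\<mu>] assms(5) by simp
  \<comment> \<open>The identity with all cycles coloured 1 has degree
    \<open>k + size \<mu>\<close>, so the bound on the degrees is attained and the top degree is
    known.\<close>
  define a0 where "a0 = (id :: nat \<Rightarrow> nat, \<lambda>u\<in>cycles k id. 1 :: nat)"
  have a0: "a0 \<in> coloured_perms k m" using assms(1) by (auto simp: a0_def coloured_perms_def)
  have "top_terms (\<Sum>a\<in>coloured_perms k m. Poly_Mapping.single (?t a) (1 :: complex))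
      = (\<Sum>a\<in>{a \<in> coloured_perms k m. monom_deg (?t a) = k + size \<mu>}. Poly_Mapping.single (?t a) 1)"
  proof (rule top_terms_sum_single[OF finite_coloured_perms _ a0])
    fix a assume a: "a \<in> coloured_perms k m"
    show "monom_deg (?t a) \<le> k + size \<mu>"
      unfolding monom_deg_coloured_exp[OF a assms(4)] size[symmetric]
      by (rule num_cycles_mult_le[OF coloured_perms_Sym[OF a] assms(4)])
  next
    show "monom_deg (?t a0) = k + size \<mu>"
      unfolding monom_deg_coloured_exp[OF a0 assms(4)] by (simp add: a0_def num_cycles_id size)
  qed
  also have "{a \<in> coloured_perms k m. monom_deg (?t a) = k + size \<mu>}
     = {a \<in> coloured_perms k m. num_cycles k (fst a) + num_cycles k (fst a \<circ> \<omega>\<^sub>\<mu>) = k + size \<mu>}"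
    using monom_deg_coloured_exp[OF _ assms(4)] by auto
  finally show ?thesis unfolding colour_monoms_eq_single F by blast
qed

end
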